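(* Fix an integer $n\ge 2$. For every $\preceq$ in $\mathsf{CTam}_{312}$, we have $$\mathcal P(\mathrm{Row}(\preceq))=\mathrm{Krew}(\mathcal P(\preceq)),$$ where $\mathrm{Row}$ is rowmotion on the cyclic Tamari lattice $\mathsf{CTam}_{312}$ and $\mathrm{Krew}$ is Kreweras complement on translation-invariant noncrossing partitions of $\mathbb Z$.
   Context: Fix an integer $n\ge 2$. A translation-invariant total order (TITO) is a total order $\preceq$ on $\mathbb Z$ such that $a\preceq b$ iff $a+n\preceq b+n$. A reflection index is a pair $(a,b)$ of integers with $a<b$, up to simultaneous translation by multiples of $n$; it is an inversion of $\preceq$ if $b\preceq a$. A TITO is $312$-avoiding if there are no integers $a<b<c$ with $c\preceq a\preceq b$. $\mathsf{CTam}_{312}$ is the set of $312$-avoiding TITOs, partially ordered by containment of inversion sets; it is a finite semidistributive lattice. Rowmotion: for a finite semidistributive lattice $L$, each join-irreducible $j$ covers a unique element $j_*$; set $\kappa(j)=\max\{z\in L\mid z\wedge j=j_*\}$. For each cover $x\lessdot y$ there is a unique join-irreducible $\mathfrak j(x\lessdot y)$ with $\mathfrak j(x\lessdot y)\vee x=y$ and $\kappa(\mathfrak j(x\lessdot y))\wedge y=x$. Let $\mathcal D(u)=\{\mathfrak j(x\lessdot u)\mid x\lessdot u\}$ and $\mathcal U(u)=\{\mathfrak j(u\lessdot y)\mid u\lessdot y\}$. Rowmotion is the unique bijection $\mathrm{Row}\colon L\to L$ with $\mathcal D(u)=\mathcal U(\mathrm{Row}(u))$ for all $u\in L$. A set partition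 $\rho$ of a totally ordered set $X$ has an associated equivalence relation $\sim_\rho$ (same block). It is noncrossing if for all $x_1<x_2<x_3<x_4$ with $x_1\sim_\rho x_3$ and $x_2\sim_\rho x_4$, one has $x_1\sim_\rho x_2$. $\rho$ is coarser than $\rho'$ (and $\rho'$ finer than $\rho$) if every block of $\rho'$ is contained in a block of $\rho$. A translation-invariant noncrossing partition (TINCP) is a noncrossing partition $\rho$ of $\mathbb Z$ (usual order) such that $a\sim_\rho b$ iff $a+n\sim_\rho b+n$. Let $\mathbb Z^\#=\{i^\#\mid i\in\mathbb Z\}$ be a disjoint order-isomorphic copy of $\mathbb Z$, and order $\mathbb Z\sqcup\mathbb Z^\#$ so that $i<i^\#<j$ whenever $i<j$ in $\mathbb Z$; for a partition $\sigma$ of $\mathbb Z$ let $\sigma^\#$ be the corresponding partition of $\mathbb Z^\#$. The Kreweras complement $\mathrm{Krew}(\rho)$ of a noncrossing partition $\rho$ of $\mathbb Z$ is the coarsest set partition $\sigma$ of $\mathbb Z$ such that $\rho\sqcup\sigma^\#$ is a noncrossing partition of $\mathbb Z\sqcup\mathbb Z^\#$. A lower wall of $\preceq$ is a reflection index $(a,b)$ (with $a<b$) such that $b\prec a$ and no integer lies strictly between them in $\preceq$. For $\preceq$ in $\mathsf{CTam}_{312}$, $\mathcal P(\preceq)$ is the finest TINCP in which $a$ and $b$ are in the same block whenever $(a,b)$ represents a lower wall of $\preceq$. *)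

theory Defs
  imports "HOL-Algebra.Lattice" "HOL-Library.FuncSet" "HOL-Library.Disjoint_Sets"
    "HOL-Library.Product_Lexorder"
begin

section \<open>Rowmotion on a finite semidistributive lattice\<close>

text \<open>
  The definitions are meant for a finite semidistributive lattice \<open>L\<close> whose equivalence is
  equality. There, \<open>x \<squnion> y = z\<close> says that \<open>z\<close> is the least element of
  \<open>Upper L {x, y}\<close>, and \<open>x \<sqinter> y = z\<close> that \<open>z\<close> is the greatest element of
  \<open>Lower L {x, y}\<close>. These relations are used instead of the total operations of
  HOL-Algebra, which return arbitrary elements where a join or meet does not exist.
\<close>

definition is_join :: "('a, 'm) gorder_scheme \<Rightarrow> 'a \<Rightarrow> 'a \<Rightarrow> 'a \<Rightarrow> bool" where
  "is_join L x y z \<longleftrightarrow> x \<in> carrier L \<and> y \<in> carrier L \<and> least L z (Upper L {x, y})"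

definition is_meet :: "('a, 'm) gorder_scheme \<Rightarrow> 'a \<Rightarrow> 'a \<Rightarrow> 'a \<Rightarrow> bool" where
  "is_meet L x y z \<longleftrightarrow> x \<in> carrier L \<and> y \<in> carrier L \<and> greatest L z (Lower L {x, y})"

definition covered_by :: "('a, 'm) gorder_scheme \<Rightarrow> 'a \<Rightarrow> 'a \<Rightarrow> bool" where
  "covered_by L x y \<longleftrightarrow> x \<in> carrier L \<and> y \<in> carrier L \<and> x \<sqsubset>\<^bsub>L\<^esub> y \<and>
     \<not> (\<exists>z\<in>carrier L. x \<sqsubset>\<^bsub>L\<^esub> z \<and> z \<sqsubset>\<^bsub>L\<^esub> y)"

definition join_irreducible :: "('a, 'm) gorder_scheme \<Rightarrow> 'a \<Rightarrow> bool" where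
  "join_irreducible L j \<longleftrightarrow> j \<in> carrier L \<and> \<not> least L j (carrier L) \<and>
     (\<forall>x y. is_join L x y j \<longrightarrow> x = j \<or> y = j)"

definition lower_star :: "('a, 'm) gorder_scheme \<Rightarrow> 'a \<Rightarrow> 'a" where
  "lower_star L j = (THE x. covered_by L x j)"

definition kappa :: "('a, 'm) gorder_scheme \<Rightarrow> 'a \<Rightarrow> 'a" where
  "kappa L j = (THE k. greatest L k {z \<in> carrier L. is_meet L z j (lower_star L j)})"

definition cover_label :: "('a, 'm) gorder_scheme \<Rightarrow> 'a \<Rightarrow> 'a \<Rightarrow> 'a" where
  "cover_label L x y =
     (THE j. join_irreducible L j \<and> is_join L j x y \<and> is_meet L (kappa L j) y x)"

definition down_labels :: "('a, 'm) gorder_scheme \<Rightarrow> 'a \<Rightarrow> 'a set" where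
  "down_labels L u = {cover_label L x u | x. covered_by L x u}"

definition up_labels :: "('a, 'm) gorder_scheme \<Rightarrow> 'a \<Rightarrow> 'a set" where
  "up_labels L u = {cover_label L u y | y. covered_by L u y}"

text \<open>Extensionality pins down the values off the carrier, so that the bijection is unique.\<close>

definition rowmotion :: "('a, 'm) gorder_scheme \<Rightarrow> 'a \<Rightarrow> 'a" where
  "rowmotion L = (THE f. f \<in> extensional (carrier L) \<and> bij_betw f (carrier L) (carrier L) \<and>
     (\<forall>u\<in>carrier L. down_labels L u = up_labels L (f u)))"


section \<open>The cyclic Tamari lattice\<close>

text \<open>A total order \<open>\<preceq>\<close> on the integers is the relation \<open>{(a, b). a \<preceq> b}\<close>.\<close>

definition tito :: "int \<Rightarrow> int rel \<Rightarrow> bool" where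
  "tito n r \<longleftrightarrow> linear_order r \<and> (\<forall>a b. (a, b) \<in> r \<longleftrightarrow> (a + n, b + n) \<in> r)"

definition translation_class :: "int \<Rightarrow> int \<Rightarrow> int \<Rightarrow> (int \<times> int) set" where
  "translation_class n a b = {(a + k * n, b + k * n) | k. True}"

definition reflection_indices :: "int \<Rightarrow> (int \<times> int) set set" where
  "reflection_indices n = {translation_class n a b | a b. a < b}"

definition inversions :: "int \<Rightarrow> int rel \<Rightarrow> (int \<times> int) set set" where
  "inversions n r = {I \<in> reflection_indices n. \<exists>(a, b)\<in>I. (b, a) \<in> r}"

definition avoids_312 :: "int rel \<Rightarrow> bool" where
  "avoids_312 r \<longleftrightarrow> \<not> (\<exists>a b c. a < b \<and> b < c \<and> (c, a) \<in> r \<and> (a, b) \<in> r)"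

definition CTam312 :: "int \<Rightarrow> int rel gorder" where
  "CTam312 n = \<lparr>carrier = {r. tito n r \<and> avoids_312 r}, eq = (=),
     le = (\<lambda>r s. inversions n r \<subseteq> inversions n s)\<rparr>"


section \<open>Noncrossing partitions and Kreweras complement\<close>

definition same_block :: "'a set set \<Rightarrow> 'a \<Rightarrow> 'a \<Rightarrow> bool" where
  "same_block \<rho> x y \<longleftrightarrow> (\<exists>B\<in>\<rho>. x \<in> B \<and> y \<in> B)"

definition noncrossing :: "'a::linorder set set \<Rightarrow> bool" where
  "noncrossing \<rho> \<longleftrightarrow> partition_on UNIV \<rho> \<and>
     (\<forall>x1 x2 x3 x4. x1 < x2 \<and> x2 < x3 \<and> x3 < x4 \<and> same_block \<rho> x1 x3 \<and> same_block \<rho> x2 x4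
        \<longrightarrow> same_block \<rho> x1 x2)"

definition tincp :: "int \<Rightarrow> int set set \<Rightarrow> bool" where
  "tincp n \<rho> \<longleftrightarrow> noncrossing \<rho> \<and> (\<forall>a b. same_block \<rho> a b \<longleftrightarrow> same_block \<rho> (a + n) (b + n))"

text \<open>
  The disjoint union of the integers with their copy is \<open>int \<times> bool\<close>, where \<open>(i, False)\<close>
  stands for \<open>i\<close> and \<open>(i, True)\<close> for the copy of \<open>i\<close>. In the lexicographic order,
  \<open>(i, False) < (i, True) < (j, False)\<close> whenever \<open>i < j\<close>.
\<close>

definition interleave :: "int set set \<Rightarrow> int set set \<Rightarrow> (int \<times> bool) set set" where
  "interleave \<rho> \<sigma> = (\<lambda>B. B \<times> {False}) ` \<rho> \<union> (\<lambda>B. B \<times> {True}) ` \<sigma>"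

definition krew :: "int set set \<Rightarrow> int set set" where
  "krew \<rho> = (THE \<sigma>. partition_on UNIV \<sigma> \<and> noncrossing (interleave \<rho> \<sigma>) \<and>
     (\<forall>\<tau>. partition_on UNIV \<tau> \<and> noncrossing (interleave \<rho> \<tau>) \<longrightarrow> refines UNIV \<tau> \<sigma>))"

definition lower_walls :: "int \<Rightarrow> int rel \<Rightarrow> (int \<times> int) set set" where
  "lower_walls n r = {I \<in> reflection_indices n. \<exists>(a, b)\<in>I. (b, a) \<in> r \<and>
     \<not> (\<exists>c. c \<noteq> a \<and> c \<noteq> b \<and> (b, c) \<in> r \<and> (c, a) \<in> r)}"

definition wall_partition :: "int \<Rightarrow> int rel \<Rightarrow> int set set" where
  "wall_partition n r = (THE \<rho>. tincp n \<rho> \<and> (\<forall>(a, b)\<in>\<Union>(lower_walls n r). same_block \<rho> a b) \<and>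
     (\<forall>\<tau>. tincp n \<tau> \<and> (\<forall>(a, b)\<in>\<Union>(lower_walls n r). same_block \<tau> a b) \<longrightarrow> refines UNIV \<rho> \<tau>))"

end

theory Submission
  imports Defs
begin

text \<open>
  A \<open>312\<close>-avoiding translation-invariant total order \<open>\<preceq>\<close> is determined by its bracket function
  \<open>h(a) = sup {c. a \<le> c \<and> c \<preceq> a}\<close>, whose values are integers or \<open>\<infinity>\<close>: avoidance of \<open>312\<close> says that
  every \<open>c\<close> with \<open>a \<le> c \<le> h(a)\<close> satisfies \<open>c \<preceq> a\<close>. The functions that occur are those with
  \<open>a \<le> h(a)\<close>, \<open>h(a + n) = h(a) + n\<close>, and \<open>h(c) \<le> h(a)\<close> whenever \<open>a \<le> c \<le> h(a)\<close>. Inversion sets are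
  compared by comparing the functions pointwise, so the cyclic Tamari lattice is a lattice of
  functions in which meets are pointwise minima. To avoid the value \<open>\<infinity>\<close>, a function \<open>h\<close> is
  represented by the relation \<open>{(a, c). a \<le> c \<le> h(a)}\<close>; then the order is inclusion and meets are
  intersections (\<open>bracket_of_carrier\<close>, \<open>CTam_le_iff\<close>, \<open>is_meet_iff\<close>).

  In these terms both sides of the theorem become explicit. The lower walls of \<open>\<preceq>\<close> are the pairs
  \<open>(a, b)\<close> of consecutive elements of a fibre of \<open>h\<close>, so \<open>P(\<preceq>)\<close> is the partition of \<open>\<int>\<close> into the
  fibres of \<open>h\<close> (\<open>wall_partition_tito_of\<close>). The lower covers of \<open>h\<close> arise by lowering \<open>h(a)\<close> to
  \<open>b - 1\<close> for one wall \<open>(a, b)\<close>, up to translation; the label of this cover is the least function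
  with \<open>h(a) \<ge> b\<close>, and each join-irreducible element has this form (\<open>lower_covers\<close>,
  \<open>cover_label_wall\<close>, \<open>join_irreducible_iff\<close>). Dually, the labels of the covers above \<open>h\<close> belong to
  the pairs \<open>(a, m + 1)\<close> where \<open>a\<close> and \<open>m\<close> are the least and the greatest element of a finite fibre
  of \<open>h\<close> (\<open>up_labels_tito_of\<close>).

  Hence rowmotion must send \<open>h\<close> to the function whose finite fibres start and end at the pairs
  \<open>(a, b - 1)\<close>, where \<open>(a, b)\<close> runs over the walls of \<open>h\<close>. Such a function exists: it sends \<open>x\<close> to
  the least \<open>b - 1\<close> over all walls \<open>(a, b)\<close> with \<open>a \<le> x < b\<close> (to \<open>\<infinity>\<close> if there are
  none), which works because the walls do not cross each other (\<open>up_wall_row_iff\<close>, \<open>rowmotion_tito_of\<close>). Two integers \<open>i < j\<close> lie in the same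
  fibre of this function if and only if no wall has exactly one end in \<open>{i<..j}\<close>, that is, if
  \<open>{i<..j}\<close> is a union of blocks of \<open>P(\<preceq>)\<close> (\<open>row_block_iff\<close>). This is exactly the condition for \<open>i\<close>
  and \<open>j\<close> to share a block of the Kreweras complement (\<open>krew_eqI\<close>), since \<open>{i<..j}\<close> consists of the
  integers between the copy of \<open>i\<close> and the copy of \<open>j\<close>.
\<close>

section \<open>Rowmotion from the labels of covers\<close>

text \<open>
  Injectivity of the upper labels leaves at most one candidate for the value of a rowmotion map at
  each element.
\<close>

lemma rowmotion_eqI:
  assumes "f \<in> extensional (carrier L)" "bij_betw f (carrier L) (carrier L)"
    and labels: "\<And>u. u \<in> carrier L \<Longrightarrow> down_labels L u = up_labels L (f u)"
    and inj: "inj_on (up_labels L) (carrier L)"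
  shows "rowmotion L = f"
  unfolding rowmotion_def
proof (rule the_equality)
  show "f \<in> extensional (carrier L) \<and> bij_betw f (carrier L) (carrier L) \<and>
    (\<forall>u\<in>carrier L. down_labels L u = up_labels L (f u))"
    using assms by blast
  fix g
  assume g: "g \<in> extensional (carrier L) \<and> bij_betw g (carrier L) (carrier L) \<and>
    (\<forall>u\<in>carrier L. down_labels L u = up_labels L (g u))"
  show "g = f"
  proof (rule extensionalityI)
    show "g u = f u" if "u \<in> carrier L" for u
    proof (rule inj_onD[OF inj])
      show "up_labels L (g u) = up_labels L (f u)" using g labels that by metis
      show "g u \<in> carrier L" "f u \<in> carrier L"
        using g assms(2) that by (auto dest: bij_betwE)
    qed
  qed (use g assms(1) in auto)
qed

section \<open>Bracket relations and their walls\<close>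

locale bracket_period =
  fixes n :: int
  assumes n_pos: "0 < n"
begin

text \<open>
  The region \<open>{(a, c). a \<le> c \<le> h(a)}\<close> below a bracket function \<open>h\<close>. Transitivity is the condition
  that \<open>h(c) \<le> h(a)\<close> whenever \<open>a \<le> c \<le> h(a)\<close>.
\<close>

definition bracket_rel :: "int rel \<Rightarrow> bool" where
  "bracket_rel R \<longleftrightarrow> (\<forall>x y. (x, y) \<in> R \<longrightarrow> x \<le> y) \<and> refl R \<and> trans R \<and>
     (\<forall>x y z. (x, z) \<in> R \<and> x \<le> y \<and> y \<le> z \<longrightarrow> (x, y) \<in> R) \<and>
     (\<forall>x y. (x, y) \<in> R \<longleftrightarrow> (x + n, y + n) \<in> R)"

lemma bracket_relI:
  assumes "\<And>x y. (x, y) \<in> R \<Longrightarrow> x \<le> y" "\<And>x. (x, x) \<in> R"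
    and "\<And>x y z. (x, y) \<in> R \<Longrightarrow> (y, z) \<in> R \<Longrightarrow> (x, z) \<in> R"
    and "\<And>x y z. (x, z) \<in> R \<Longrightarrow> x \<le> y \<Longrightarrow> y \<le> z \<Longrightarrow> (x, y) \<in> R"
    and "\<And>x y. (x + n, y + n) \<in> R \<longleftrightarrow> (x, y) \<in> R"
  shows "bracket_rel R"
  unfolding bracket_rel_def refl_on_def trans_def using assms by blast

lemma bracket_le: "bracket_rel R \<Longrightarrow> (x, y) \<in> R \<Longrightarrow> x \<le> y"
  unfolding bracket_rel_def by blast

lemma bracket_refl: "bracket_rel R \<Longrightarrow> (x, x) \<in> R"
  unfolding bracket_rel_def refl_on_def by blast

lemma bracket_trans: "bracket_rel R \<Longrightarrow> (x, y) \<in> R \<Longrightarrow> (y, z) \<in> R \<Longrightarrow> (x, z) \<in> R"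
  unfolding bracket_rel_def trans_def by blast

lemma bracket_convex: "bracket_rel R \<Longrightarrow> (x, z) \<in> R \<Longrightarrow> x \<le> y \<Longrightarrow> y \<le> z \<Longrightarrow> (x, y) \<in> R"
  unfolding bracket_rel_def by blast

lemma bracket_shift_n: "bracket_rel R \<Longrightarrow> (x + n, y + n) \<in> R \<longleftrightarrow> (x, y) \<in> R"
  unfolding bracket_rel_def by blast

lemma shift_multiple:
  assumes "\<And>x y. (x + n, y + n) \<in> R \<longleftrightarrow> (x, y) \<in> R"
  shows "(x + k * n, y + k * n) \<in> R \<longleftrightarrow> (x, y) \<in> R"
proof (induction k rule: int_induct[where k = 0])
  case (step1 i)
  then show ?case using assms[of "x + i * n" "y + i * n"] by (simp add: algebra_simps)
next
  case (step2 i)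
  then show ?case using assms[of "x + (i - 1) * n" "y + (i - 1) * n"] by (simp add: algebra_simps)
qed simp

lemmas bracket_shift = shift_multiple[OF bracket_shift_n]

text \<open>
  If \<open>h(a) \<ge> a + n\<close> then \<open>h(a) \<ge> h(a + n) = h(a) + n\<close>, so \<open>h(a) = \<infinity>\<close>. Finite values of \<open>h\<close> at \<open>a\<close>
  are therefore less than \<open>a + n\<close>.
\<close>

lemma unbounded_bracket:
  assumes R: "bracket_rel R" and "(x, x + n) \<in> R" and "x \<le> y"
  shows "(x, y) \<in> R"
proof -
  have reach: "(x, x + int k * n) \<in> R" for k
  proof (induction k)
    case 0
    then show ?case using R bracket_refl by simp
  next
    case (Suc k)
    have "(x + int k * n, x + n + int k * n) \<in> R"
      using assms(2) bracket_shift[OF R] by blast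
    then show ?case using Suc bracket_trans[OF R] by (fastforce simp: algebra_simps)
  qed
  have "(y - x) * 1 \<le> (y - x) * n"
    using n_pos \<open>x \<le> y\<close> by (intro mult_left_mono) auto
  then have "y \<le> x + int (nat (y - x)) * n" using \<open>x \<le> y\<close> by simp
  then show ?thesis using reach bracket_convex[OF R] \<open>x \<le> y\<close> by blast
qed

text \<open>
  Consecutive elements of a fibre of \<open>h\<close>. The last condition, with \<open>(a, b) \<in> R\<close>, says
  \<open>h(a) = h(b)\<close>. An element \<open>c\<close> of the same fibre between \<open>a\<close> and \<open>b\<close> would satisfy \<open>h(c) \<ge> b\<close>;
  conversely \<open>h(c) \<ge> b\<close> gives \<open>h(c) \<ge> h(b) = h(a)\<close> and hence puts \<open>c\<close> in the fibre.
\<close>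

definition wall :: "int rel \<Rightarrow> int \<Rightarrow> int \<Rightarrow> bool" where
  "wall R a b \<longleftrightarrow> a < b \<and> (a, b) \<in> R \<and> (\<forall>c. a < c \<and> c < b \<longrightarrow> (c, b) \<notin> R) \<and>
     (\<forall>d\<ge>b. (a, d) \<in> R \<longrightarrow> (b, d) \<in> R)"

lemma wall_shift:
  assumes R: "bracket_rel R"
  shows "wall R (a + k * n) (b + k * n) \<longleftrightarrow> wall R a b"
proof -
  have imp: "wall R (a + k * n) (b + k * n)" if W: "wall R a b" for a b k
    unfolding wall_def
  proof (intro conjI allI impI)
    show "a + k * n < b + k * n" "(a + k * n, b + k * n) \<in> R"
      using W bracket_shift[OF R] by (auto simp: wall_def)
    show "(c, b + k * n) \<notin> R" if "a + k * n < c \<and> c < b + k * n" for c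
    proof -
      have "(c - k * n, b) \<notin> R" using W that by (auto simp: wall_def)
      then show ?thesis using bracket_shift[OF R, of "c - k * n" k b] by simp
    qed
    show "(b + k * n, d) \<in> R" if "b + k * n \<le> d" "(a + k * n, d) \<in> R" for d
    proof -
      have "(a, d - k * n) \<in> R" using that bracket_shift[OF R, of a k "d - k * n"] by simp
      then have "(b, d - k * n) \<in> R" using W that by (auto simp: wall_def)
      then show ?thesis using bracket_shift[OF R, of b k "d - k * n"] by simp
    qed
  qed
  show ?thesis using imp[of a b k] imp[of "a + k * n" "b + k * n" "- k"] by auto
qed

lemma wall_length:
  assumes R: "bracket_rel R" and W: "wall R a b"
  shows "b \<le> a + n"
proof (rule ccontr)
  assume less: "\<not> b \<le> a + n"
  have "(a, a + n) \<in> R" using bracket_convex[OF R, of a b] W less n_pos by (auto simp: wall_def)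
  then have "(a + n, a + n + n) \<in> R" using bracket_shift_n[OF R] by blast
  then have "(a + n, b) \<in> R" using unbounded_bracket[OF R] less by auto
  then show False using W less n_pos by (auto simp: wall_def)
qed

lemma walls_do_not_cross:
  assumes R: "bracket_rel R" and "wall R a b" "wall R a' b'" and "a' \<le> a" "a < b'"
  shows "b \<le> b'"
proof (rule ccontr)
  assume *: "\<not> b \<le> b'"
  then have ab': "(a, b') \<in> R" using assms bracket_convex[OF R, of a b b'] by (auto simp: wall_def)
  show False
  proof (cases "a' = a")
    case True
    then have "(b', b) \<in> R" using assms * by (auto simp: wall_def)
    then show False using assms * True by (auto simp: wall_def)
  next
    case False
    then show False using assms ab' by (auto simp: wall_def)
  qed
qed

text \<open>
  The hypotheses say that \<open>d\<close> lies in the fibre of \<open>c\<close>, so the least element of this fibre above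
  \<open>c\<close> exists and is at most \<open>d\<close>.
\<close>

lemma next_in_block:
  assumes R: "bracket_rel R" and cd: "(c, d) \<in> R" "c < d"
    and block: "\<And>e. d \<le> e \<Longrightarrow> (c, e) \<in> R \<Longrightarrow> (d, e) \<in> R"
  shows "\<exists>b. wall R c b \<and> b \<le> d"
proof -
  \<comment> \<open>The elements of the fibre of \<open>c\<close> above \<open>c\<close>; the least of them is the right end of the wall.\<close>
  define Q where "Q b \<longleftrightarrow> (c, b) \<in> R \<and> c < b \<and> (\<forall>e\<ge>b. (c, e) \<in> R \<longrightarrow> (b, e) \<in> R)" for b
  have "Q d" using cd block by (auto simp: Q_def)
  define m where "m = (LEAST m. Q (c + int m))"
  have ex: "Q (c + int (nat (d - c)))" using \<open>Q d\<close> cd by simp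
  have Qm: "Q (c + int m)" unfolding m_def by (rule LeastI, rule ex)
  have m_le: "m \<le> nat (d - c)" unfolding m_def by (rule Least_le, rule ex)
  define b where "b = c + int m"
  have "(e, b) \<notin> R" if "c < e" "e < b" for e
  proof
    assume eb: "(e, b) \<in> R"
    have "(e, f) \<in> R" if "e \<le> f" "(c, f) \<in> R" for f
    proof (cases "f \<le> b")
      case True
      then show ?thesis using bracket_convex[OF R eb] that by blast
    next
      case False
      then have "(b, f) \<in> R" using Qm that by (auto simp: Q_def b_def)
      then show ?thesis using bracket_trans[OF R eb] by blast
    qed
    moreover have "(c, e) \<in> R"
      using Qm that bracket_convex[OF R] by (auto simp: Q_def b_def)
    ultimately have "Q (c + int (nat (e - c)))" using \<open>c < e\<close> by (simp add: Q_def)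
    then have "m \<le> nat (e - c)" unfolding m_def by (rule Least_le)
    then show False using that by (simp add: b_def)
  qed
  then have "wall R c b" using Qm by (auto simp: wall_def Q_def b_def)
  moreover have "b \<le> d" using m_le cd by (simp add: b_def)
  ultimately show ?thesis by blast
qed

text \<open>
  If \<open>h(c)\<close> is finite and greater than \<open>c\<close>, then \<open>h(c)\<close> itself is a later element of the fibre of
  \<open>c\<close>; if \<open>h(c) = \<infinity>\<close>, then \<open>c + n\<close> is one.
\<close>

lemma wall_exists:
  assumes R: "bracket_rel R" and cd: "(c, d) \<in> R" "c < d"
  shows "\<exists>b. wall R c b"
proof (cases "(c, c + n) \<in> R")
  case True
  then have "(c + n, e) \<in> R" if "c + n \<le> e" for e
    using that unbounded_bracket[OF R] bracket_shift_n[OF R] by blast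
  then have "\<exists>b. wall R c b \<and> b \<le> c + n"
    using n_pos by (intro next_in_block[OF R True]) auto
  then show ?thesis by blast
next
  case False
  then have bound: "e \<le> c + n" if "(c, e) \<in> R" for e
    using that bracket_convex[OF R, of c e "c + n"] n_pos by fastforce
  define m where "m = Max {e. (c, e) \<in> R}"
  have "{e. (c, e) \<in> R} \<subseteq> {c..c + n}" using bound bracket_le[OF R] by auto
  then have fin: "finite {e. (c, e) \<in> R}" by (rule finite_subset) simp
  have cm: "(c, m) \<in> R" using Max_in[OF fin] cd(1) unfolding m_def by blast
  have le_m: "e \<le> m" if "(c, e) \<in> R" for e using Max_ge[OF fin] that unfolding m_def by blast
  have "c < m" using le_m cd by force
  moreover have "(m, e) \<in> R" if "m \<le> e" "(c, e) \<in> R" for e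
    using le_m[OF that(2)] that bracket_refl[OF R] by auto
  ultimately have "\<exists>b. wall R c b \<and> b \<le> m" by (intro next_in_block[OF R cm])
  then show ?thesis by blast
qed

text \<open>
  From \<open>c\<close> with \<open>(c, d) \<in> R\<close>, walk along the fibre of \<open>c\<close>, one wall at a time, until \<open>d\<close> is reached
  or passed. So a bracket relation is the join of the join-irreducible relations of its walls, and
  is determined by them.
\<close>

lemma walls_generate:
  assumes R: "bracket_rel R" and Z: "bracket_rel Z"
    and walls: "\<And>a b. wall R a b \<Longrightarrow> (a, b) \<in> Z"
  shows "R \<subseteq> Z"
proof -
  have "(c, d) \<in> Z" if "(c, d) \<in> R" for c d
    using that
  proof (induction "nat (d - c)" arbitrary: c rule: less_induct)
    case less
    show ?case
    proof (cases "c = d")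
      case True
      then show ?thesis using bracket_refl[OF Z] by simp
    next
      case False
      then have "c < d" using bracket_le[OF R less.prems] by simp
      obtain b where b: "wall R c b" using wall_exists[OF R less.prems \<open>c < d\<close>] by blast
      show ?thesis
      proof (cases "b \<le> d")
        case True
        then have "(b, d) \<in> R" using b less.prems by (auto simp: wall_def)
        then have "(b, d) \<in> Z" using less.hyps[of b] b \<open>c < d\<close> by (auto simp: wall_def)
        then show ?thesis using walls[OF b] bracket_trans[OF Z] by blast
      next
        case False
        then show ?thesis using walls[OF b] bracket_convex[OF Z] \<open>c < d\<close> by fastforce
      qed
    qed
  qed
  then show ?thesis by auto
qed

section \<open>Join-irreducible relations and their kappa images\<close>

text \<open>
  The function with \<open>h(a) = b\<close> and its translates, equal to the identity elsewhere. Here \<open>b\<close> ranges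
  over \<open>{a<..a + n}\<close>, and \<open>b = a + n\<close> encodes \<open>h(a) = \<infinity>\<close>.
\<close>

definition join_irred_rel :: "int \<Rightarrow> int \<Rightarrow> int rel" where
  "join_irred_rel a b = {(x, y). x \<le> y \<and> (x = y \<or> n dvd x - a \<and> (b = a + n \<or> y - x \<le> b - a))}"

text \<open>
  The largest function with \<open>h(a) = b - 1\<close>: it has the value \<open>b - 1\<close> on the window \<open>{a..<b}\<close>,
  correspondingly on its translates, and is infinite elsewhere.
\<close>

definition kappa_rel :: "int \<Rightarrow> int \<Rightarrow> int rel" where
  "kappa_rel a b = {(x, y). x \<le> y \<and> (\<forall>k. a + k * n \<le> x \<and> x < b + k * n \<longrightarrow> y < b + k * n)}"

lemma bracket_join_irred:
  assumes "a < b" "b \<le> a + n"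
  shows "bracket_rel (join_irred_rel a b)"
proof -
  have trans: "(x, z) \<in> join_irred_rel a b"
    if xy: "(x, y) \<in> join_irred_rel a b" and yz: "(y, z) \<in> join_irred_rel a b" for x y z
  proof (cases "x = y \<or> y = z")
    case True
    then show ?thesis using xy yz by blast
  next
    case False
    then have *: "n dvd x - a" "n dvd y - a" "x < y" "y < z" "b = a + n \<or> y - x \<le> b - a"
      using xy yz unfolding join_irred_rel_def by simp_all
    have "n dvd y - x" using dvd_diff[OF *(2,1)] by simp
    then have "n \<le> y - x" using *(3) zdvd_imp_le by simp
    then have "b = a + n" using * assms by linarith
    then show ?thesis using * unfolding join_irred_rel_def by simp
  qed
  have "n dvd x + n - a \<longleftrightarrow> n dvd x - a" for x
    using dvd_add_left_iff[of n n "x - a"] by (simp add: algebra_simps)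
  then have "(x + n, y + n) \<in> join_irred_rel a b \<longleftrightarrow> (x, y) \<in> join_irred_rel a b" for x y
    unfolding join_irred_rel_def by simp
  moreover have "(x, y) \<in> join_irred_rel a b"
    if "(x, z) \<in> join_irred_rel a b" "x \<le> y" "y \<le> z" for x y z
    using that unfolding join_irred_rel_def by simp linarith
  moreover have "x \<le> y" if "(x, y) \<in> join_irred_rel a b" for x y
    using that unfolding join_irred_rel_def by simp
  moreover have "(x, x) \<in> join_irred_rel a b" for x
    unfolding join_irred_rel_def by simp
  ultimately show ?thesis
    unfolding bracket_rel_def refl_on_def using trans by (blast intro: transI)
qed

lemma join_irred_subset_iff:
  assumes "a < b" "b \<le> a + n" and Z: "bracket_rel Z"
  shows "join_irred_rel a b \<subseteq> Z \<longleftrightarrow> (a, b) \<in> Z"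
proof
  assume "join_irred_rel a b \<subseteq> Z"
  then show "(a, b) \<in> Z" using assms by (auto simp: join_irred_rel_def)
next
  assume ab: "(a, b) \<in> Z"
  have "(x, y) \<in> Z" if xy: "(x, y) \<in> join_irred_rel a b" for x y
  proof (cases "x = y")
    case True
    then show ?thesis using bracket_refl[OF Z] by simp
  next
    case False
    then obtain k where k: "x = a + k * n"
      using xy by (auto simp: join_irred_rel_def dvd_def algebra_simps)
    then have xb: "(x, b + k * n) \<in> Z" using ab bracket_shift[OF Z] by blast
    show ?thesis
    proof (cases "b = a + n")
      case True
      then show ?thesis using xb k xy unbounded_bracket[OF Z, of x y]
        by (auto simp: join_irred_rel_def algebra_simps)
    next
      case False
      then show ?thesis using xb k xy \<open>x \<noteq> y\<close> bracket_convex[OF Z xb, of y]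
        by (auto simp: join_irred_rel_def)
    qed
  qed
  then show "join_irred_rel a b \<subseteq> Z" by auto
qed

lemma join_irred_shift: "join_irred_rel (a + k * n) (b + k * n) = join_irred_rel a b"
proof -
  have "n dvd x - (a + k * n) \<longleftrightarrow> n dvd x - a" for x
    using dvd_diff_left_iff[of n "k * n" "x - a"] by (simp add: algebra_simps)
  then show ?thesis by (auto simp: join_irred_rel_def)
qed

lemma bracket_kappa: "bracket_rel (kappa_rel a b)"
proof -
  have shift: "(x + n, y + n) \<in> kappa_rel a b \<longleftrightarrow> (x, y) \<in> kappa_rel a b" for x y
  proof -
    have "(\<forall>k. a + k * n \<le> x + n \<and> x + n < b + k * n \<longrightarrow> y + n < b + k * n) \<longleftrightarrow>
      (\<forall>k. a + (k + 1) * n \<le> x + n \<and> x + n < b + (k + 1) * n \<longrightarrow> y + n < b + (k + 1) * n)"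
      by (metis diff_add_cancel)
    then show ?thesis by (simp add: kappa_rel_def algebra_simps)
  qed
  have "(x, z) \<in> kappa_rel a b"
    if xy: "(x, y) \<in> kappa_rel a b" and yz: "(y, z) \<in> kappa_rel a b" for x y z
  proof -
    have "x \<le> y" "y \<le> z" using xy yz unfolding kappa_rel_def by simp_all
    moreover have "z < b + k * n" if k: "a + k * n \<le> x" "x < b + k * n" for k
    proof -
      have "y < b + k * n" using xy k unfolding kappa_rel_def by blast
      moreover have "a + k * n \<le> y" using k \<open>x \<le> y\<close> by simp
      ultimately show ?thesis using yz unfolding kappa_rel_def by blast
    qed
    ultimately show ?thesis unfolding kappa_rel_def by simp
  qed
  then have "trans (kappa_rel a b)" by (rule transI)
  moreover have "(x, y) \<in> kappa_rel a b" if "(x, z) \<in> kappa_rel a b" "x \<le> y" "y \<le> z" for x y z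
    using that order.strict_trans1 unfolding kappa_rel_def by blast
  moreover have "x \<le> y" if "(x, y) \<in> kappa_rel a b" for x y
    using that unfolding kappa_rel_def by simp
  moreover have "(x, x) \<in> kappa_rel a b" for x
    unfolding kappa_rel_def by simp
  ultimately show ?thesis
    unfolding bracket_rel_def refl_on_def using shift by blast
qed

lemma bracket_Int: "bracket_rel R \<Longrightarrow> bracket_rel S \<Longrightarrow> bracket_rel (R \<inter> S)"
  by (rule bracket_relI) (auto simp: bracket_le bracket_refl bracket_shift_n
    intro: bracket_trans bracket_convex)

lemma pair_notin_kappa:
  assumes "a < b"
  shows "(a, b) \<notin> kappa_rel a b"
proof
  assume "(a, b) \<in> kappa_rel a b"
  then have "a + 0 * n \<le> a \<and> a < b + 0 * n \<longrightarrow> b < b + 0 * n"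
    unfolding kappa_rel_def by blast
  then show False using assms by simp
qed

text \<open>
  A point lies in at most one translate of a window, so the quantifier over \<open>k\<close> in \<open>kappa_rel\<close> has at
  most one effective instance for each \<open>x\<close>.
\<close>

lemma window_unique:
  assumes "b \<le> a + n" "a + k * n \<le> x" "x < b + k * n" "a + l * n \<le> x" "x < b + l * n"
  shows "k = l"
proof -
  have "\<not> k < l" if "a + k * n \<le> x" "x < b + k * n" "a + l * n \<le> x" "x < b + l * n" for k l
  proof
    assume "k < l"
    then have "(k + 1) * n \<le> l * n" using n_pos by (simp add: mult_right_mono)
    then show False using that assms(1) by (simp add: algebra_simps)
  qed
  then show ?thesis using assms by (meson linorder_less_linear)
qed

text \<open>
  If \<open>(x, y) \<in> Z\<close> led from the window \<open>{a..<b}\<close> to \<open>y \<ge> b\<close>, then \<open>(a, x)\<close> and \<open>(x, b)\<close> would be in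
  \<open>Z\<close> by convexity, and \<open>(a, b)\<close> by transitivity.
\<close>

lemma subset_kappa:
  assumes "a < b" "b \<le> a + n" and Z: "bracket_rel Z"
    and "(a, b - 1) \<in> Z" "(a, b) \<notin> Z"
  shows "Z \<subseteq> kappa_rel a b"
proof clarify
  fix x y assume xy: "(x, y) \<in> Z"
  have "y < b + k * n" if "a + k * n \<le> x" "x < b + k * n" for k
  proof (rule ccontr)
    assume "\<not> y < b + k * n"
    then have "(x, b + k * n) \<in> Z" using bracket_convex[OF Z xy] that by simp
    moreover have "(a + k * n, b - 1 + k * n) \<in> Z" using assms(4) bracket_shift[OF Z] by blast
    then have "(a + k * n, x) \<in> Z" using bracket_convex[OF Z] that by fastforce
    ultimately have "(a + k * n, b + k * n) \<in> Z" using bracket_trans[OF Z] by blast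
    then show False using assms(5) bracket_shift[OF Z] by blast
  qed
  then show "(x, y) \<in> kappa_rel a b" using bracket_le[OF Z xy] by (simp add: kappa_rel_def)
qed

text \<open>
  A wall \<open>(a, b)\<close> has no \<open>c\<close> strictly inside with \<open>(c, b) \<in> R\<close>. So the only pairs that are lost on
  intersecting with the kappa relation start at a translate of \<open>a\<close>.
\<close>

lemma wall_outside_kappa:
  assumes R: "bracket_rel R" and W: "wall R a b"
    and xy: "(x, y) \<in> R" "(x, y) \<notin> kappa_rel a b"
  obtains k where "x = a + k * n" "b + k * n \<le> y"
proof -
  obtain k where k: "a + k * n \<le> x" "x < b + k * n" "b + k * n \<le> y"
    using xy bracket_le[OF R xy(1)] by (auto simp: kappa_rel_def not_less)
  have "wall R (a + k * n) (b + k * n)" using W wall_shift[OF R] by blast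
  moreover have "(x, b + k * n) \<in> R" using bracket_convex[OF R xy(1)] k by simp
  ultimately have "\<not> a + k * n < x" using k unfolding wall_def by blast
  then have "x = a + k * n" using k by simp
  then show thesis using that k by blast
qed

text \<open>
  This lemma and the next one show that nothing lies strictly between \<open>R\<close> and its intersection with
  the kappa relation of a wall: a relation \<open>Z\<close> between the two is the lower or the upper one
  according to whether it contains the wall.
\<close>

lemma below_wall:
  assumes R: "bracket_rel R" and W: "wall R a b" and Z: "bracket_rel Z"
    and "Z \<subseteq> R" "(a, b) \<notin> Z"
  shows "Z \<subseteq> R \<inter> kappa_rel a b"
proof clarify
  fix x y assume xy: "(x, y) \<in> Z"
  have "(x, y) \<in> kappa_rel a b"
  proof (rule ccontr)
    assume "(x, y) \<notin> kappa_rel a b"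
    then obtain k where k: "x = a + k * n" "b + k * n \<le> y"
      using wall_outside_kappa[OF R W] xy assms by blast
    then have "(a + k * n, b + k * n) \<in> Z"
      using bracket_convex[OF Z xy] W by (simp add: wall_def)
    then show False using assms bracket_shift[OF Z] by blast
  qed
  then show "(x, y) \<in> R \<inter> kappa_rel a b" using assms xy by blast
qed

lemma above_wall:
  assumes R: "bracket_rel R" and W: "wall R a b" and Z: "bracket_rel Z"
    and sub: "R \<inter> kappa_rel a b \<subseteq> Z" and ab: "(a, b) \<in> Z"
  shows "R \<subseteq> Z"
proof clarify
  fix x y assume xy: "(x, y) \<in> R"
  show "(x, y) \<in> Z"
  proof (cases "(x, y) \<in> kappa_rel a b")
    case True
    then show ?thesis using sub xy by blast
  next
    case False
    then obtain k where k: "x = a + k * n" "b + k * n \<le> y"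
      using wall_outside_kappa[OF R W xy] by blast
    have xb: "(x, b + k * n) \<in> Z" using ab k bracket_shift[OF Z] by blast
    have "wall R x (b + k * n)" using W k wall_shift[OF R] by blast
    then have b_y: "(b + k * n, y) \<in> R" using k xy by (auto simp: wall_def)
    show ?thesis
    proof (cases "(b + k * n, y) \<in> kappa_rel a b")
      case True
      then show ?thesis using sub b_y xb bracket_trans[OF Z] by blast
    next
      \<comment> \<open>If the second step, from \<open>b\<close> to \<open>y\<close> up to translation, is lost as well, then \<open>b\<close> is a translate of \<open>a\<close>, so \<open>b = a + n\<close>.\<close>
      case False
      then obtain l where l: "b + k * n = a + l * n"
        using wall_outside_kappa[OF R W b_y] by blast
      then have ba: "b - a = (l - k) * n" by (simp add: algebra_simps)
      have "0 < (l - k) * n" "(l - k) * n \<le> 1 * n"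
        unfolding ba[symmetric] using W wall_length[OF R W] by (auto simp: wall_def)
      then have "0 < l - k" "l - k \<le> 1"
        using n_pos zero_less_mult_pos2 mult_right_le_imp_le by blast+
      then have "l - k = 1" by simp
      then have "b = a + n" using ba by simp
      then have "(x, x + n) \<in> Z" using xb k by (simp add: algebra_simps)
      then show ?thesis using unbounded_bracket[OF Z] bracket_le[OF R xy] by blast
    qed
  qed
qed

section \<open>Upper walls\<close>

text \<open>
  The integers \<open>a\<close> and \<open>b - 1\<close> are the least and the greatest element of a finite fibre of \<open>h\<close>. The
  first conditions say \<open>h(a) = b - 1\<close>; the last one excludes \<open>c < a\<close> in the same fibre, since
  \<open>h(c) \<ge> a\<close> leaves only \<open>h(c) = b - 1\<close> and \<open>h(c) \<ge> b\<close>.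
\<close>

definition up_wall :: "int rel \<Rightarrow> int \<Rightarrow> int \<Rightarrow> bool" where
  "up_wall V a b \<longleftrightarrow> a < b \<and> b \<le> a + n \<and> (a, b - 1) \<in> V \<and> (a, b) \<notin> V \<and>
     (\<forall>c<a. (c, a) \<in> V \<longrightarrow> (c, b) \<in> V)"

lemma up_wall_translate:
  assumes V: "bracket_rel V" and up: "up_wall V a b" and "c < a + k * n" "(c, a + k * n) \<in> V"
  shows "(c, b + k * n) \<in> V"
proof -
  have "(c - k * n, a) \<in> V" using assms bracket_shift[OF V, of "c - k * n" k a] by simp
  then have "(c - k * n, b) \<in> V" using assms by (auto simp: up_wall_def)
  then show ?thesis using bracket_shift[OF V, of "c - k * n" k b] by simp
qed

lemma wall_up_wall:
  assumes Y: "bracket_rel Y" and W: "wall Y a b"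
  shows "up_wall (Y \<inter> kappa_rel a b) a b"
  unfolding up_wall_def
proof (intro conjI allI impI)
  let ?V = "Y \<inter> kappa_rel a b"
  have ab: "a < b" "b \<le> a + n" "(a, b) \<in> Y"
    using W wall_length[OF Y W] by (auto simp: wall_def)
  then show "a < b" "b \<le> a + n" by auto
  show "(a, b) \<notin> ?V" using pair_notin_kappa[OF ab(1)] by blast
  have "b - 1 < b + k * n" if "a + k * n \<le> a" "a < b + k * n" for k
    using window_unique[OF ab(2), of k a 0] ab that by simp
  then show "(a, b - 1) \<in> ?V"
    using ab bracket_convex[OF Y ab(3)] by (simp add: kappa_rel_def)
  fix c assume "c < a" and ca: "(c, a) \<in> ?V"
  have "b < b + k * n" if k: "a + k * n \<le> c" "c < b + k * n" for k
  proof -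
    have "a < b + k * n" using ca k by (auto simp: kappa_rel_def)
    moreover have "a + k * n \<le> a" using k \<open>c < a\<close> by simp
    ultimately have "k = 0" using window_unique[OF ab(2), of k a 0] ab by simp
    then show ?thesis using k \<open>c < a\<close> by simp
  qed
  moreover have "c \<le> b" using \<open>c < a\<close> ab by simp
  ultimately have "(c, b) \<in> kappa_rel a b" unfolding kappa_rel_def by blast
  then show "(c, b) \<in> ?V" using ca ab bracket_trans[OF Y] by blast
qed

text \<open>
  The cover of \<open>V\<close> raises \<open>h(a)\<close> from \<open>b - 1\<close> to \<open>h(b)\<close>, and to \<open>\<infinity>\<close> if \<open>b = a + n\<close>. Minimality of
  \<open>a\<close> in its fibre is what keeps the raised function a bracket function: every \<open>c < a\<close> with
  \<open>h(c) \<ge> a\<close> already satisfies \<open>h(c) \<ge> h(b)\<close>.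
\<close>

lemma up_wall_cover:
  assumes V: "bracket_rel V" and up: "up_wall V a b"
  obtains Y where "bracket_rel Y" "wall Y a b" "V = Y \<inter> kappa_rel a b"
proof -
  \<comment> \<open>At a translate \<open>x\<close> of \<open>a\<close>, the translate of \<open>b\<close> is \<open>x + (b - a)\<close>.\<close>
  define Y where "Y = {(x, y). (x, y) \<in> V \<or>
    n dvd x - a \<and> (b = a + n \<and> x \<le> y \<or> (x + (b - a), y) \<in> V)}"
  have ab: "a < b" "b \<le> a + n" "(a, b - 1) \<in> V" "(a, b) \<notin> V" using up by (auto simp: up_wall_def)
  have up': "(x, y + (b - a)) \<in> V" if "n dvd y - a" "(x, y) \<in> V" "x < y" for x y
  proof -
    obtain k where "y = a + k * n" using \<open>n dvd y - a\<close> by (auto simp: dvd_def algebra_simps)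
    then show ?thesis using up_wall_translate[OF V up] that by (simp add: algebra_simps)
  qed
  have base: "(x, x + (b - a) - 1) \<in> V" if "n dvd x - a" for x
  proof -
    obtain k where "x = a + k * n" using \<open>n dvd x - a\<close> by (auto simp: dvd_def algebra_simps)
    then show ?thesis using bracket_shift[OF V, of a k "b - 1"] ab by (simp add: algebra_simps)
  qed
  have dvd_shift: "n dvd x + n - a \<longleftrightarrow> n dvd x - a" for x
    using dvd_add_left_iff[of n n "x - a"] by (simp add: algebra_simps)
  have Y_le: "x \<le> y" if "(x, y) \<in> Y" for x y
    using that ab bracket_le[OF V] by (fastforce simp: Y_def)
  have Y_refl: "(x, x) \<in> Y" for x using bracket_refl[OF V] by (simp add: Y_def)
  have Y_trans: "(x, z) \<in> Y" if xy: "(x, y) \<in> Y" and yz: "(y, z) \<in> Y" for x y z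
  proof (cases "(x, y) \<in> V")
    case xyV: True
    show ?thesis
    proof (cases "(y, z) \<in> V \<or> x = y")
      case True
      then show ?thesis using xyV yz bracket_trans[OF V] by (auto simp: Y_def)
    next
      case False
      then have y: "n dvd y - a" "x < y" "b = a + n \<and> y \<le> z \<or> (y + (b - a), z) \<in> V"
        using yz Y_le[OF xy] by (auto simp: Y_def)
      then have xyb: "(x, y + (b - a)) \<in> V" using up' xyV by blast
      have "(x, z) \<in> V"
      proof (cases "b = a + n \<and> y \<le> z")
        case True
        then have "(x, x + n) \<in> V" using bracket_convex[OF V xyb, of "x + n"] y n_pos by simp
        then show ?thesis using unbounded_bracket[OF V] True y by simp
      next
        case False
        then show ?thesis using y xyb bracket_trans[OF V] by blast
      qed
      then show ?thesis by (simp add: Y_def)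
    qed
  next
    case False
    then have x: "n dvd x - a" "b = a + n \<and> x \<le> y \<or> (x + (b - a), y) \<in> V"
      using xy by (auto simp: Y_def)
    show ?thesis
    proof (cases "b = a + n")
      case True
      then show ?thesis using x Y_le[OF xy] Y_le[OF yz] by (simp add: Y_def)
    next
      case False
      then have xby: "(x + (b - a), y) \<in> V" using x by blast
      have "(x + (b - a), z) \<in> V"
      proof (cases "(y, z) \<in> V")
        case True
        then show ?thesis using xby bracket_trans[OF V] by blast
      next
        case False
        then have y: "n dvd y - a" "(y + (b - a), z) \<in> V" using yz \<open>b \<noteq> a + n\<close> by (auto simp: Y_def)
        have "x + (b - a) \<noteq> y"
        proof
          assume "x + (b - a) = y"
          then have "(y - a) - (x - a) = b - a" by simp
          then have "n dvd b - a" using dvd_diff[OF y(1) x(1)] by metis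
          then show False using ab \<open>b \<noteq> a + n\<close> zdvd_imp_le[of n "b - a"] by simp
        qed
        then have "(x + (b - a), y + (b - a)) \<in> V"
          using up'[OF y(1) xby] bracket_le[OF V xby] by simp
        then show ?thesis using y bracket_trans[OF V] by blast
      qed
      then show ?thesis using x by (simp add: Y_def)
    qed
  qed
  have Y_convex: "(x, y) \<in> Y" if xz: "(x, z) \<in> Y" and "x \<le> y" "y \<le> z" for x y z
  proof (cases "(x, z) \<in> V")
    case True
    then show ?thesis using that bracket_convex[OF V True] by (simp add: Y_def)
  next
    case False
    then have x: "n dvd x - a" "b = a + n \<and> x \<le> z \<or> (x + (b - a), z) \<in> V"
      using xz by (auto simp: Y_def)
    then show ?thesis
      using that base[OF x(1)] bracket_convex[OF V, of "x + (b - a)" z y]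
        bracket_convex[OF V, of x "x + (b - a) - 1" y]
      by (cases "x + (b - a) \<le> y") (auto simp: Y_def)
  qed
  have Y_shift: "(x + n, y + n) \<in> Y \<longleftrightarrow> (x, y) \<in> Y" for x y
  proof -
    have "(x + n + (b - a), y + n) \<in> V \<longleftrightarrow> (x + (b - a), y) \<in> V"
      using bracket_shift_n[OF V, of "x + (b - a)" y] by (simp add: algebra_simps)
    then show ?thesis unfolding Y_def using bracket_shift_n[OF V, of x y] dvd_shift[of x] by simp
  qed
  have Y: "bracket_rel Y"
    using Y_le Y_refl Y_trans Y_convex Y_shift by (rule bracket_relI)
  have no_dvd: "\<not> n dvd c - a" if "a < c" "c < b" for c
    using that ab zdvd_imp_le[of n "c - a"] by auto
  have W: "wall Y a b"
    unfolding wall_def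
  proof (intro conjI allI impI)
    show "a < b" by fact
    show "(a, b) \<in> Y" using bracket_refl[OF V] by (simp add: Y_def)
    show "(c, b) \<notin> Y" if c: "a < c \<and> c < b" for c
    proof
      assume "(c, b) \<in> Y"
      then have "(c, b) \<in> V" using no_dvd c by (simp add: Y_def)
      moreover have "(a, c) \<in> V" using bracket_convex[OF V ab(3)] c by simp
      ultimately show False using ab bracket_trans[OF V] by blast
    qed
    show "(b, d) \<in> Y" if "b \<le> d" "(a, d) \<in> Y" for d
    proof -
      have "(a, d) \<notin> V" using ab that bracket_convex[OF V, of a d b] by auto
      then have "b = a + n \<or> (b, d) \<in> V" using that by (auto simp: Y_def)
      then show ?thesis using that by (auto simp: Y_def)
    qed
  qed
  have "V = Y \<inter> kappa_rel a b"
  proof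
    show "V \<subseteq> Y \<inter> kappa_rel a b"
      using subset_kappa[OF ab(1,2) V ab(3,4)] by (auto simp: Y_def)
    show "Y \<inter> kappa_rel a b \<subseteq> V"
    proof clarify
      fix x y assume xy: "(x, y) \<in> Y" "(x, y) \<in> kappa_rel a b"
      show "(x, y) \<in> V"
      proof (rule ccontr)
        assume "(x, y) \<notin> V"
        then have "n dvd x - a" using xy by (auto simp: Y_def)
        then obtain k where k: "x = a + k * n" by (auto simp: dvd_def algebra_simps)
        then have "y < b + k * n" using xy ab by (auto simp: kappa_rel_def)
        then have "(x, y) \<in> V"
          using bracket_convex[OF V base[OF \<open>n dvd x - a\<close>], of y] Y_le[OF xy(1)] k by simp
        then show False using \<open>(x, y) \<notin> V\<close> by blast
      qed
    qed
  qed
  then show thesis using that Y W by blast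
qed

text \<open>
  Dual to \<open>walls_generate\<close>. Suppose \<open>(c, d) \<in> Z\<close> with \<open>m = h(c) < d\<close>, where \<open>h\<close> belongs to \<open>V\<close>. The
  fibre of \<open>h\<close> over \<open>m\<close> is finite; let \<open>a\<close> be its least element. Then \<open>(a, m + 1)\<close> is an upper wall,
  and its window contains \<open>c\<close> but not \<open>d\<close>.
\<close>

lemma up_walls_generate:
  assumes V: "bracket_rel V" and Z: "bracket_rel Z"
    and up: "\<And>a b. up_wall V a b \<Longrightarrow> Z \<subseteq> kappa_rel a b"
  shows "Z \<subseteq> V"
proof clarify
  fix c d assume cd: "(c, d) \<in> Z"
  show "(c, d) \<in> V"
  proof (rule ccontr)
    assume notV: "(c, d) \<notin> V"
    define m where "m = Max {e. (c, e) \<in> V}"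
    have "e < d" if "(c, e) \<in> V" for e
      using bracket_convex[OF V that] notV bracket_le[OF Z cd] by (meson not_le)
    then have "{e. (c, e) \<in> V} \<subseteq> {c..d}" using bracket_le[OF V] by fastforce
    then have fin: "finite {e. (c, e) \<in> V}" by (rule finite_subset) simp
    have cm: "(c, m) \<in> V" using Max_in[OF fin] bracket_refl[OF V] unfolding m_def by blast
    have "e \<le> m" if "(c, e) \<in> V" for e using Max_ge[OF fin] that unfolding m_def by blast
    then have cm1: "(c, m + 1) \<notin> V" by fastforce
    have "m < d" using \<open>\<And>e. (c, e) \<in> V \<Longrightarrow> e < d\<close> cm by blast
    \<comment> \<open>The fibre over \<open>m\<close>.\<close>
    define A where "A = {a. (a, m) \<in> V \<and> (a, m + 1) \<notin> V}"
    define a where "a = Min A"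
    have bound: "m < a + n" "a \<le> m" if "a \<in> A" for a
      using that unbounded_bracket[OF V, of a "m + 1"] bracket_convex[OF V, of a m "a + n"]
        bracket_le[OF V, of a m] n_pos by (fastforce simp: A_def)+
    then have "A \<subseteq> {m - n..m}" by fastforce
    then have finA: "finite A" by (rule finite_subset) simp
    have "c \<in> A" using cm cm1 by (simp add: A_def)
    then have aA: "a \<in> A" and "a \<le> c" using Min_in[OF finA] Min_le[OF finA] by (auto simp: a_def)
    have "up_wall V a (m + 1)"
      unfolding up_wall_def
    proof (intro conjI allI impI)
      show "a < m + 1" "m + 1 \<le> a + n" "(a, m + 1 - 1) \<in> V" "(a, m + 1) \<notin> V"
        using bound[OF aA] aA by (auto simp: A_def)
      fix e assume "e < a" "(e, a) \<in> V"
      then have "(e, m) \<in> V" "e \<notin> A"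
        using aA bracket_trans[OF V] Min_le[OF finA, of e] by (auto simp: A_def a_def)
      then show "(e, m + 1) \<in> V" by (simp add: A_def)
    qed
    then have "(c, d) \<in> kappa_rel a (m + 1)" using up cd by blast
    then have "a + 0 * n \<le> c \<and> c < m + 1 + 0 * n \<longrightarrow> d < m + 1 + 0 * n"
      unfolding kappa_rel_def by blast
    then show False using \<open>a \<le> c\<close> \<open>m < d\<close> bracket_le[OF V cm] by simp
  qed
qed

section \<open>The image of a bracket relation under rowmotion\<close>

text \<open>
  The intersection of the kappa relations of all walls of \<open>R\<close>. By \<open>up_walls_generate\<close> this is the
  only relation whose upper walls can be the walls of \<open>R\<close>. The translates of a wall are walls too, so
  no multiples of the period appear.
\<close>

definition row_rel :: "int rel \<Rightarrow> int rel" where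
  "row_rel R = {(x, y). x \<le> y \<and> (\<forall>a b. wall R a b \<and> a \<le> x \<and> x < b \<longrightarrow> y < b)}"

lemma bracket_row:
  assumes R: "bracket_rel R"
  shows "bracket_rel (row_rel R)"
proof -
  have shift: "(x + n, y + n) \<in> row_rel R \<longleftrightarrow> (x, y) \<in> row_rel R" for x y
  proof -
    have "(\<forall>a b. wall R a b \<and> a \<le> x + n \<and> x + n < b \<longrightarrow> y + n < b) \<longleftrightarrow>
      (\<forall>a b. wall R (a + n) (b + n) \<and> a + n \<le> x + n \<and> x + n < b + n \<longrightarrow> y + n < b + n)"
      by (metis diff_add_cancel)
    then show ?thesis using wall_shift[OF R, of _ 1] by (simp add: row_rel_def)
  qed
  have "(x, z) \<in> row_rel R" if xy: "(x, y) \<in> row_rel R" and yz: "(y, z) \<in> row_rel R" for x y z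
  proof -
    have "x \<le> y" "y \<le> z" using xy yz unfolding row_rel_def by simp_all
    moreover have "z < b" if ab: "wall R a b" "a \<le> x" "x < b" for a b
    proof -
      have "y < b" using xy ab unfolding row_rel_def by blast
      moreover have "a \<le> y" using ab \<open>x \<le> y\<close> by simp
      ultimately show ?thesis using yz ab unfolding row_rel_def by blast
    qed
    ultimately show ?thesis unfolding row_rel_def by auto
  qed
  then have "trans (row_rel R)" by (rule transI)
  moreover have "(x, y) \<in> row_rel R" if "(x, z) \<in> row_rel R" "x \<le> y" "y \<le> z" for x y z
    using that order.strict_trans1 unfolding row_rel_def by blast
  moreover have "x \<le> y" if "(x, y) \<in> row_rel R" for x y
    using that unfolding row_rel_def by simp
  moreover have "(x, x) \<in> row_rel R" for x
    unfolding row_rel_def by simp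
  ultimately show ?thesis
    unfolding bracket_rel_def refl_on_def using shift by blast
qed

text \<open>
  Windows of walls are nested or disjoint, and no two of them with different left ends have the same
  right end. Hence the window of a wall \<open>(a, b)\<close> is not cut before \<open>b\<close> by another wall, and every \<open>c < a\<close>
  that reaches \<open>a\<close> also reaches \<open>b\<close>.
\<close>

lemma up_wall_row_iff:
  assumes R: "bracket_rel R"
  shows "up_wall (row_rel R) a b \<longleftrightarrow> wall R a b"
proof
  let ?S = "row_rel R"
  have up: "up_wall ?S a b" if W: "wall R a b" for a b
    unfolding up_wall_def
  proof (intro conjI allI impI)
    show "a < b" "b \<le> a + n" using W wall_length[OF R W] by (auto simp: wall_def)
    show "(a, b) \<notin> ?S" using W by (auto simp: row_rel_def wall_def)
    show "(a, b - 1) \<in> ?S"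
      using walls_do_not_cross[OF R W] \<open>a < b\<close> by (fastforce simp: row_rel_def)
    fix c assume "c < a" and ca: "(c, a) \<in> ?S"
    have "b < b'" if W': "wall R a' b'" and c: "a' \<le> c" "c < b'" for a' b'
    proof -
      have "a < b'" using ca W' c by (auto simp: row_rel_def)
      then have "b \<le> b'" using walls_do_not_cross[OF R W W'] c \<open>c < a\<close> by simp
      moreover have "b \<noteq> b'"
      proof
        assume "b = b'"
        then show False using W W' c \<open>c < a\<close> by (auto simp: wall_def)
      qed
      ultimately show ?thesis by simp
    qed
    then show "(c, b) \<in> ?S" using \<open>c < a\<close> \<open>a < b\<close> by (auto simp: row_rel_def)
  qed
  show "up_wall ?S a b" if "wall R a b" using up that .
  assume ab: "up_wall ?S a b"
  then obtain a' b' where W: "wall R a' b'" and a': "a' \<le> a" "a < b'" "b' \<le> b"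
    by (auto simp: row_rel_def up_wall_def not_less)
  have "b - 1 < b'" using ab W a' by (auto simp: row_rel_def up_wall_def)
  then have "b' = b" using a' by simp
  have "\<not> a' < a"
  proof
    assume "a' < a"
    have "(a', b - 1) \<in> ?S" "(a', b) \<notin> ?S" using up[OF W] \<open>b' = b\<close> by (auto simp: up_wall_def)
    then have "(a', a) \<in> ?S" using bracket_convex[OF bracket_row[OF R]] ab \<open>a' < a\<close>
      by (fastforce simp: up_wall_def)
    then show False using ab \<open>a' < a\<close> \<open>(a', b) \<notin> ?S\<close> by (auto simp: up_wall_def)
  qed
  then show "wall R a b" using W \<open>b' = b\<close> a' by simp
qed

end

section \<open>Total orders as bracket relations\<close>

definition tito_of :: "int rel \<Rightarrow> int rel" where
  "tito_of R = {(x, y). if y \<le> x then (y, x) \<in> R else (x, y) \<notin> R}"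

definition bracket_of :: "int rel \<Rightarrow> int rel" where
  "bracket_of r = {(a, c). a \<le> c \<and> (c, a) \<in> r}"

lemma linear_order_iff:
  "linear_order r \<longleftrightarrow> (\<forall>x. (x, x) \<in> r) \<and> (\<forall>x y z. (x, y) \<in> r \<longrightarrow> (y, z) \<in> r \<longrightarrow> (x, z) \<in> r) \<and>
     (\<forall>x y. (x, y) \<in> r \<longrightarrow> (y, x) \<in> r \<longrightarrow> x = y) \<and> (\<forall>x y. (x, y) \<in> r \<or> (y, x) \<in> r)"
  unfolding linear_order_on_def partial_order_on_def preorder_on_def refl_on_def trans_def
    antisym_def total_on_def by simp (intro conj_cong refl; metis)

context bracket_period
begin

lemma tito_of_in_carrier:
  assumes R: "bracket_rel R"
  shows "tito_of R \<in> carrier (CTam312 n)"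
proof -
  note le = bracket_le[OF R] and refl = bracket_refl[OF R] and tr = bracket_trans[OF R]
    and convex = bracket_convex[OF R]
  have trans: "(x, z) \<in> tito_of R" if xy: "(x, y) \<in> tito_of R" and yz: "(y, z) \<in> tito_of R" for x y z
  proof (cases "y \<le> x"; cases "z \<le> y")
    assume "y \<le> x" "z \<le> y"
    then show ?thesis using xy yz tr[of z y x] by (simp add: tito_of_def)
  next
    assume "y \<le> x" "\<not> z \<le> y"
    then show ?thesis using xy yz tr[of y x z] convex[of y x z] by (auto simp: tito_of_def)
  next
    assume "\<not> y \<le> x" "z \<le> y"
    then show ?thesis using xy yz tr[of x z y] convex[of z y x] by (auto simp: tito_of_def)
  next
    assume "\<not> y \<le> x" "\<not> z \<le> y"
    then show ?thesis using xy yz convex[of x z y] by (auto simp: tito_of_def)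
  qed
  have "linear_order (tito_of R)"
    unfolding linear_order_iff
  proof (intro conjI allI impI)
    show "(x, x) \<in> tito_of R" for x by (simp add: tito_of_def refl)
    show "(x, z) \<in> tito_of R" if "(x, y) \<in> tito_of R" "(y, z) \<in> tito_of R" for x y z
      using that by (rule trans)
    show "x = y" if "(x, y) \<in> tito_of R" "(y, x) \<in> tito_of R" for x y
      using that by (auto simp: tito_of_def split: if_splits)
    show "(x, y) \<in> tito_of R \<or> (y, x) \<in> tito_of R" for x y
      by (auto simp: tito_of_def refl)
  qed
  moreover have "(x, y) \<in> tito_of R \<longleftrightarrow> (x + n, y + n) \<in> tito_of R" for x y
    using bracket_shift_n[OF R] by (simp add: tito_of_def)
  moreover have "avoids_312 (tito_of R)"
    unfolding avoids_312_def
  proof clarify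
    fix a b c :: int
    assume "a < b" "b < c" "(c, a) \<in> tito_of R" "(a, b) \<in> tito_of R"
    then show False using convex[of a c b] by (simp add: tito_of_def)
  qed
  ultimately show ?thesis unfolding CTam312_def tito_def by simp
qed

lemma bracket_of_carrier:
  assumes "r \<in> carrier (CTam312 n)"
  shows "bracket_rel (bracket_of r)" and "tito_of (bracket_of r) = r"
proof -
  have lin: "linear_order r" and shift: "\<And>a b. (a, b) \<in> r \<longleftrightarrow> (a + n, b + n) \<in> r"
    and avoid: "\<And>a b c. a < b \<Longrightarrow> b < c \<Longrightarrow> (c, a) \<in> r \<Longrightarrow> (a, b) \<notin> r"
    using assms unfolding CTam312_def tito_def avoids_312_def by simp_all
  have refl: "(x, x) \<in> r" and trans: "(x, y) \<in> r \<Longrightarrow> (y, z) \<in> r \<Longrightarrow> (x, z) \<in> r"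
    and antisym: "(x, y) \<in> r \<Longrightarrow> (y, x) \<in> r \<Longrightarrow> x = y" and total: "(x, y) \<in> r \<or> (y, x) \<in> r" for x y z
    using lin unfolding linear_order_iff by blast+
  show "bracket_rel (bracket_of r)"
  proof (rule bracket_relI)
    show "(x, z) \<in> bracket_of r" if "(x, y) \<in> bracket_of r" "(y, z) \<in> bracket_of r" for x y z
      using that trans[of z y x] by (auto simp: bracket_of_def)
    show "(x, y) \<in> bracket_of r" if "(x, z) \<in> bracket_of r" "x \<le> y" "y \<le> z" for x y z
    proof (cases "x = y \<or> y = z")
      case True
      then show ?thesis using that refl by (auto simp: bracket_of_def)
    next
      case False
      then have "(x, y) \<notin> r" using avoid[of x y z] that by (auto simp: bracket_of_def)
      then show ?thesis using total that by (auto simp: bracket_of_def)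
    qed
    show "(x + n, y + n) \<in> bracket_of r \<longleftrightarrow> (x, y) \<in> bracket_of r" for x y
      using shift[of y x] by (simp add: bracket_of_def)
  qed (auto simp: bracket_of_def refl)
  have "(x, y) \<in> tito_of (bracket_of r) \<longleftrightarrow> (x, y) \<in> r" for x y
    using total[of x y] antisym[of x y] by (auto simp: tito_of_def bracket_of_def)
  then show "tito_of (bracket_of r) = r" by auto
qed

lemma bracket_of_tito_of: "bracket_rel R \<Longrightarrow> bracket_of (tito_of R) = R"
  using bracket_le by (auto simp: bracket_of_def tito_of_def)

lemma carrier_eq: "carrier (CTam312 n) = tito_of ` {R. bracket_rel R}"
  using tito_of_in_carrier bracket_of_carrier by (fastforce simp: image_iff)

lemma carrier_cases:
  assumes "r \<in> carrier (CTam312 n)"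
  obtains R where "bracket_rel R" "r = tito_of R"
  using assms carrier_eq by blast

lemma tito_of_eq_iff: "bracket_rel R \<Longrightarrow> bracket_rel S \<Longrightarrow> tito_of R = tito_of S \<longleftrightarrow> R = S"
  using bracket_of_tito_of by metis

text \<open>
  Inversion sets consist of translation classes; invariance makes the choice of a representative
  immaterial.
\<close>

lemma inversion_iff:
  assumes R: "bracket_rel R" and "a < b"
  shows "translation_class n a b \<in> inversions n (tito_of R) \<longleftrightarrow> (a, b) \<in> R"
proof
  assume "translation_class n a b \<in> inversions n (tito_of R)"
  then obtain k where "(b + k * n, a + k * n) \<in> tito_of R"
    unfolding inversions_def translation_class_def by auto
  then have "(a + k * n, b + k * n) \<in> R" using \<open>a < b\<close> by (simp add: tito_of_def)
  then show "(a, b) \<in> R" using bracket_shift[OF R] by blast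
next
  assume "(a, b) \<in> R"
  then have "(b, a) \<in> tito_of R" using \<open>a < b\<close> by (simp add: tito_of_def)
  moreover have "(a, b) \<in> translation_class n a b"
    unfolding translation_class_def by (auto intro: exI[of _ 0])
  ultimately show "translation_class n a b \<in> inversions n (tito_of R)"
    using \<open>a < b\<close> unfolding inversions_def reflection_indices_def by blast
qed

lemma CTam_le_iff:
  assumes R: "bracket_rel R" and S: "bracket_rel S"
  shows "tito_of R \<sqsubseteq>\<^bsub>CTam312 n\<^esub> tito_of S \<longleftrightarrow> R \<subseteq> S"
proof -
  have "inversions n (tito_of R) \<subseteq> {translation_class n a b | a b. a < b}"
    unfolding inversions_def reflection_indices_def by blast
  then have "inversions n (tito_of R) \<subseteq> inversions n (tito_of S) \<longleftrightarrow>
    (\<forall>a b. a < b \<longrightarrow> (a, b) \<in> R \<longrightarrow> (a, b) \<in> S)"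
    using inversion_iff[OF R] inversion_iff[OF S] by blast
  also have "\<dots> \<longleftrightarrow> R \<subseteq> S"
    using bracket_le[OF R] bracket_refl[OF S] by (fastforce simp: order_less_le)
  finally show ?thesis by (simp add: CTam312_def)
qed

lemma CTam_less_iff:
  "bracket_rel R \<Longrightarrow> bracket_rel S \<Longrightarrow> tito_of R \<sqsubset>\<^bsub>CTam312 n\<^esub> tito_of S \<longleftrightarrow> R \<subset> S"
  using CTam_le_iff[of R S] tito_of_eq_iff[of R S]
  unfolding lless_def by (simp add: CTam312_def psubset_eq)

lemma bex_carrier: "(\<exists>z\<in>carrier (CTam312 n). P z) \<longleftrightarrow> (\<exists>Z. bracket_rel Z \<and> P (tito_of Z))"
  unfolding carrier_eq by blast

lemma ball_carrier: "(\<forall>z\<in>carrier (CTam312 n). P z) \<longleftrightarrow> (\<forall>Z. bracket_rel Z \<longrightarrow> P (tito_of Z))"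
  unfolding carrier_eq by blast

lemma ball_within: "A \<subseteq> B \<Longrightarrow> (\<forall>x\<in>A. P x) \<longleftrightarrow> (\<forall>x\<in>B. x \<in> A \<longrightarrow> P x)"
  by blast

section \<open>Covers, join-irreducible elements and labels\<close>

lemma covered_by_iff:
  assumes R: "bracket_rel R" and S: "bracket_rel S"
  shows "covered_by (CTam312 n) (tito_of R) (tito_of S) \<longleftrightarrow>
    R \<subset> S \<and> \<not> (\<exists>Z. bracket_rel Z \<and> R \<subset> Z \<and> Z \<subset> S)"
proof -
  have "(\<exists>z\<in>carrier (CTam312 n). tito_of R \<sqsubset>\<^bsub>CTam312 n\<^esub> z \<and> z \<sqsubset>\<^bsub>CTam312 n\<^esub> tito_of S) \<longleftrightarrow>
    (\<exists>Z. bracket_rel Z \<and> R \<subset> Z \<and> Z \<subset> S)"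
    unfolding bex_carrier using CTam_less_iff[OF R] CTam_less_iff[OF _ S] by metis
  then show ?thesis
    unfolding covered_by_def
    using CTam_less_iff[OF R S] tito_of_in_carrier[OF R] tito_of_in_carrier[OF S] by metis
qed

lemma is_meet_iff:
  assumes A: "bracket_rel A" and B: "bracket_rel B" and C: "bracket_rel C"
  shows "is_meet (CTam312 n) (tito_of A) (tito_of B) (tito_of C) \<longleftrightarrow> C = A \<inter> B"
proof -
  have lower: "tito_of Z \<in> Lower (CTam312 n) {tito_of A, tito_of B} \<longleftrightarrow> Z \<subseteq> A \<inter> B" if "bracket_rel Z" for Z
    using that tito_of_in_carrier A B CTam_le_iff unfolding Lower_def by auto
  have sub: "Lower (CTam312 n) {tito_of A, tito_of B} \<subseteq> carrier (CTam312 n)"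
    unfolding Lower_def by blast
  have "greatest (CTam312 n) (tito_of C) (Lower (CTam312 n) {tito_of A, tito_of B}) \<longleftrightarrow>
    C \<subseteq> A \<inter> B \<and> (\<forall>z\<in>carrier (CTam312 n). z \<in> Lower (CTam312 n) {tito_of A, tito_of B} \<longrightarrow>
      z \<sqsubseteq>\<^bsub>CTam312 n\<^esub> tito_of C)"
    unfolding greatest_def lower[OF C] ball_within[OF sub] using sub by simp
  also have "\<dots> \<longleftrightarrow> C \<subseteq> A \<inter> B \<and> (\<forall>Z. bracket_rel Z \<longrightarrow> Z \<subseteq> A \<inter> B \<longrightarrow> Z \<subseteq> C)"
    unfolding ball_carrier using lower CTam_le_iff[OF _ C] by metis
  also have "\<dots> \<longleftrightarrow> C = A \<inter> B" using bracket_Int[OF A B] by blast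
  finally show ?thesis
    using tito_of_in_carrier[OF A] tito_of_in_carrier[OF B] unfolding is_meet_def by simp
qed

lemma is_join_iff:
  assumes A: "bracket_rel A" and B: "bracket_rel B" and C: "bracket_rel C"
  shows "is_join (CTam312 n) (tito_of A) (tito_of B) (tito_of C) \<longleftrightarrow>
    A \<union> B \<subseteq> C \<and> (\<forall>Z. bracket_rel Z \<longrightarrow> A \<union> B \<subseteq> Z \<longrightarrow> C \<subseteq> Z)"
proof -
  have upper: "tito_of Z \<in> Upper (CTam312 n) {tito_of A, tito_of B} \<longleftrightarrow> A \<union> B \<subseteq> Z" if "bracket_rel Z" for Z
    using that tito_of_in_carrier A B CTam_le_iff unfolding Upper_def by auto
  have sub: "Upper (CTam312 n) {tito_of A, tito_of B} \<subseteq> carrier (CTam312 n)"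
    unfolding Upper_def by blast
  have "least (CTam312 n) (tito_of C) (Upper (CTam312 n) {tito_of A, tito_of B}) \<longleftrightarrow>
    A \<union> B \<subseteq> C \<and> (\<forall>z\<in>carrier (CTam312 n). z \<in> Upper (CTam312 n) {tito_of A, tito_of B} \<longrightarrow>
      tito_of C \<sqsubseteq>\<^bsub>CTam312 n\<^esub> z)"
    unfolding least_def upper[OF C] ball_within[OF sub] using sub by simp
  also have "\<dots> \<longleftrightarrow> A \<union> B \<subseteq> C \<and> (\<forall>Z. bracket_rel Z \<longrightarrow> A \<union> B \<subseteq> Z \<longrightarrow> C \<subseteq> Z)"
    unfolding ball_carrier using upper CTam_le_iff[OF C] by metis
  finally show ?thesis
    using tito_of_in_carrier[OF A] tito_of_in_carrier[OF B] unfolding is_join_def by simp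
qed

lemma lower_covers:
  assumes X: "bracket_rel X" and R: "bracket_rel R"
  shows "covered_by (CTam312 n) (tito_of X) (tito_of R) \<longleftrightarrow>
    (\<exists>a b. wall R a b \<and> X = R \<inter> kappa_rel a b)"
proof -
  have strict: "R \<inter> kappa_rel a b \<subset> R" if "wall R a b" for a b
    using that pair_notin_kappa[of a b] by (auto simp: wall_def)
  show ?thesis
    unfolding covered_by_iff[OF X R]
  proof
    assume cov: "X \<subset> R \<and> \<not> (\<exists>Z. bracket_rel Z \<and> X \<subset> Z \<and> Z \<subset> R)"
    then obtain a b where W: "wall R a b" "(a, b) \<notin> X"
      using walls_generate[OF R X] by blast
    then have "X \<subseteq> R \<inter> kappa_rel a b" using below_wall[OF R _ X] cov by blast
    moreover have "bracket_rel (R \<inter> kappa_rel a b)" by (intro bracket_Int R bracket_kappa)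
    ultimately have "X = R \<inter> kappa_rel a b" using cov strict[OF W(1)] by blast
    then show "\<exists>a b. wall R a b \<and> X = R \<inter> kappa_rel a b" using W by blast
  next
    assume "\<exists>a b. wall R a b \<and> X = R \<inter> kappa_rel a b"
    then obtain a b where W: "wall R a b" and X_eq: "X = R \<inter> kappa_rel a b" by blast
    have "Z = X \<or> Z = R" if Z: "bracket_rel Z" "X \<subseteq> Z" "Z \<subseteq> R" for Z
    proof (cases "(a, b) \<in> Z")
      case True
      then have "R \<subseteq> Z" using above_wall[OF R W Z(1)] X_eq Z by blast
      then show ?thesis using Z by blast
    next
      case False
      then have "Z \<subseteq> X" using below_wall[OF R W Z(1,3)] X_eq by blast
      then show ?thesis using Z by blast
    qed
    then show "X \<subset> R \<and> \<not> (\<exists>Z. bracket_rel Z \<and> X \<subset> Z \<and> Z \<subset> R)"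
      using strict[OF W] X_eq by blast
  qed
qed

lemma wall_join_irred:
  assumes "a < b" "b \<le> a + n"
  shows "wall (join_irred_rel a b) a b"
proof -
  have "\<not> n dvd c - a" if "a < c" "c < b" for c
    using that assms zdvd_imp_le[of n "c - a"] by auto
  then show ?thesis using assms unfolding wall_def join_irred_rel_def by auto
qed

lemma below_join_irred:
  assumes "a < b" "b \<le> a + n" and Z: "bracket_rel Z" and "Z \<subset> join_irred_rel a b"
  shows "Z \<subseteq> join_irred_rel a b \<inter> kappa_rel a b"
proof -
  have "(a, b) \<notin> Z" using join_irred_subset_iff[OF assms(1,2) Z] assms by blast
  then show ?thesis
    using below_wall[OF bracket_join_irred wall_join_irred Z] assms by blast
qed

lemma lower_star_join_irred:
  assumes ab: "a < b" "b \<le> a + n"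
  shows "lower_star (CTam312 n) (tito_of (join_irred_rel a b)) =
    tito_of (join_irred_rel a b \<inter> kappa_rel a b)"
proof -
  let ?J = "join_irred_rel a b"
  note J = bracket_join_irred[OF ab]
  have JK: "bracket_rel (?J \<inter> kappa_rel a b)" by (intro bracket_Int J bracket_kappa)
  show ?thesis
    unfolding lower_star_def
  proof (rule the_equality)
    show "covered_by (CTam312 n) (tito_of (?J \<inter> kappa_rel a b)) (tito_of ?J)"
      using lower_covers[OF JK J] wall_join_irred[OF ab] by blast
    fix x assume cov: "covered_by (CTam312 n) x (tito_of ?J)"
    then obtain X where X: "bracket_rel X" "x = tito_of X"
      by (auto simp: covered_by_def elim: carrier_cases)
    then have strict: "X \<subset> ?J" and none: "\<And>Z. bracket_rel Z \<Longrightarrow> X \<subset> Z \<Longrightarrow> \<not> Z \<subset> ?J"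
      using cov covered_by_iff[OF X(1) J] by blast+
    have "?J \<inter> kappa_rel a b \<subset> ?J"
      using wall_join_irred[OF ab] pair_notin_kappa[OF ab(1)] by (auto simp: wall_def)
    then show "x = tito_of (?J \<inter> kappa_rel a b)"
      using below_join_irred[OF ab X(1) strict] none[OF JK] X by blast
  qed
qed

text \<open>
  A relation with a wall \<open>(a, b)\<close> is the join of the lower cover that this wall defines and the
  join-irreducible relation of \<open>(a, b)\<close>. If it is join-irreducible, it therefore equals the latter.
  Conversely, everything strictly below the relation of \<open>(a, b)\<close> is below its unique lower cover.
\<close>

lemma join_irreducible_iff:
  assumes R: "bracket_rel R"
  shows "join_irreducible (CTam312 n) (tito_of R) \<longleftrightarrow>
    (\<exists>a b. a < b \<and> b \<le> a + n \<and> R = join_irred_rel a b)"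
proof
  assume irr: "join_irreducible (CTam312 n) (tito_of R)"
  have join: "X = R \<or> Y = R" if XY: "bracket_rel X" "bracket_rel Y" and "X \<union> Y \<subseteq> R"
    "\<And>Z. bracket_rel Z \<Longrightarrow> X \<union> Y \<subseteq> Z \<Longrightarrow> R \<subseteq> Z" for X Y
  proof -
    have "is_join (CTam312 n) (tito_of X) (tito_of Y) (tito_of R)"
      unfolding is_join_iff[OF XY R] using that by simp
    then have "tito_of X = tito_of R \<or> tito_of Y = tito_of R"
      using irr unfolding join_irreducible_def by simp
    then show ?thesis using tito_of_eq_iff XY R by simp
  qed
  have "\<exists>Z. bracket_rel Z \<and> \<not> R \<subseteq> Z"
    using irr tito_of_in_carrier[OF R] CTam_le_iff[OF R]
    unfolding join_irreducible_def least_def ball_carrier by blast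
  then obtain a b where W: "wall R a b" using walls_generate[OF R] by blast
  have ab: "a < b" "b \<le> a + n" "(a, b) \<in> R" using W wall_length[OF R W] by (auto simp: wall_def)
  have K: "bracket_rel (R \<inter> kappa_rel a b)" by (intro bracket_Int R bracket_kappa)
  have "join_irred_rel a b = R \<or> R \<inter> kappa_rel a b = R"
  proof (rule join[OF bracket_join_irred[OF ab(1,2)] K])
    show "join_irred_rel a b \<union> R \<inter> kappa_rel a b \<subseteq> R"
      using join_irred_subset_iff[OF ab(1,2) R] ab by simp
    show "R \<subseteq> Z" if Z: "bracket_rel Z" "join_irred_rel a b \<union> R \<inter> kappa_rel a b \<subseteq> Z" for Z
      using above_wall[OF R W Z(1)] join_irred_subset_iff[OF ab(1,2) Z(1)] Z(2) by simp
  qed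
  then have "R = join_irred_rel a b" using pair_notin_kappa[OF ab(1)] ab by blast
  then show "\<exists>a b. a < b \<and> b \<le> a + n \<and> R = join_irred_rel a b" using ab by blast
next
  assume "\<exists>a b. a < b \<and> b \<le> a + n \<and> R = join_irred_rel a b"
  then obtain a b where ab: "a < b" "b \<le> a + n" and R_eq: "R = join_irred_rel a b" by blast
  let ?K = "R \<inter> kappa_rel a b"
  have K: "bracket_rel ?K" by (intro bracket_Int R bracket_kappa)
  have not_sub: "\<not> R \<subseteq> ?K"
    using wall_join_irred[OF ab] pair_notin_kappa[OF ab(1)] R_eq by (auto simp: wall_def)
  have "x = tito_of R \<or> y = tito_of R" if join: "is_join (CTam312 n) x y (tito_of R)" for x y
  proof -
    obtain X Y where XY: "bracket_rel X" "x = tito_of X" "bracket_rel Y" "y = tito_of Y"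
      using join by (auto simp: is_join_def elim!: carrier_cases)
    then have sub: "X \<union> Y \<subseteq> R" "\<And>Z. bracket_rel Z \<Longrightarrow> X \<union> Y \<subseteq> Z \<Longrightarrow> R \<subseteq> Z"
      using join is_join_iff[OF XY(1,3) R] by simp_all
    have "\<not> (X \<subseteq> ?K \<and> Y \<subseteq> ?K)" using sub(2)[OF K] not_sub by blast
    then have "X = R \<or> Y = R"
      using below_join_irred[OF ab XY(1)] below_join_irred[OF ab XY(3)] sub(1) R_eq by blast
    then show ?thesis using XY by blast
  qed
  moreover have "\<not> least (CTam312 n) (tito_of R) (carrier (CTam312 n))"
    using K not_sub CTam_le_iff[OF R K] unfolding least_def ball_carrier by blast
  ultimately show "join_irreducible (CTam312 n) (tito_of R)"
    using tito_of_in_carrier[OF R] unfolding join_irreducible_def by blast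
qed

text \<open>
  Meeting the join-irreducible relation of \<open>(a, b)\<close> in its lower cover means to contain
  \<open>(a, b - 1)\<close> but not \<open>(a, b)\<close>, and the kappa relation is the greatest one of this kind.
\<close>

lemma kappa_join_irred:
  assumes ab: "a < b" "b \<le> a + n"
  shows "kappa (CTam312 n) (tito_of (join_irred_rel a b)) = tito_of (kappa_rel a b)"
proof -
  let ?J = "join_irred_rel a b" and ?K = "kappa_rel a b"
  note J = bracket_join_irred[OF ab]
  have JK: "bracket_rel (?J \<inter> ?K)" by (intro bracket_Int J bracket_kappa)
  define M where "M = {z \<in> carrier (CTam312 n).
    is_meet (CTam312 n) z (tito_of ?J) (lower_star (CTam312 n) (tito_of ?J))}"
  have M_iff: "tito_of Z \<in> M \<longleftrightarrow> ?J \<inter> ?K = Z \<inter> ?J" if Z: "bracket_rel Z" for Z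
    using is_meet_iff[OF Z J JK] tito_of_in_carrier[OF Z]
    by (simp add: M_def lower_star_join_irred[OF ab])
  have KM: "tito_of ?K \<in> M" using M_iff[OF bracket_kappa] by blast
  have below: "Z \<subseteq> ?K" if Z: "bracket_rel Z" "tito_of Z \<in> M" for Z
  proof (rule subset_kappa[OF ab Z(1)])
    have eq: "?J \<inter> ?K = Z \<inter> ?J" using Z M_iff by blast
    have W: "wall ?J a b" by (rule wall_join_irred[OF ab])
    then show "(a, b) \<notin> Z" using eq pair_notin_kappa[OF ab(1)] by (auto simp: wall_def)
    have "(a, b - 1) \<in> ?J \<inter> ?K"
      using wall_up_wall[OF J W] by (simp add: up_wall_def)
    then show "(a, b - 1) \<in> Z" using eq by blast
  qed
  have great: "greatest (CTam312 n) (tito_of ?K) M"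
    unfolding greatest_def
  proof (intro conjI ballI)
    show "M \<subseteq> carrier (CTam312 n)" unfolding M_def by blast
    show "tito_of ?K \<in> M" by (rule KM)
    fix z assume "z \<in> M"
    then obtain Z where "bracket_rel Z" "z = tito_of Z" by (auto simp: M_def elim: carrier_cases)
    then show "z \<sqsubseteq>\<^bsub>CTam312 n\<^esub> tito_of ?K"
      using below \<open>z \<in> M\<close> CTam_le_iff bracket_kappa by blast
  qed
  have "kappa (CTam312 n) (tito_of ?J) = (THE k. greatest (CTam312 n) k M)"
    unfolding kappa_def M_def ..
  also have "\<dots> = tito_of ?K"
  proof (rule the_equality[where P = "\<lambda>k. greatest (CTam312 n) k M", OF great])
    fix k assume k: "greatest (CTam312 n) k M"
    then obtain Z where Z: "bracket_rel Z" "k = tito_of Z"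
      by (auto simp: M_def greatest_def elim: carrier_cases)
    have "tito_of ?K \<sqsubseteq>\<^bsub>CTam312 n\<^esub> tito_of Z" "tito_of Z \<in> M"
      using k KM Z unfolding greatest_def by blast+
    then have "?K \<subseteq> Z" "Z \<subseteq> ?K"
      using CTam_le_iff[OF bracket_kappa Z(1)] below[OF Z(1)] by simp_all
    then show "k = tito_of ?K" unfolding Z(2) by (metis subset_antisym)
  qed
  finally show ?thesis .
qed

text \<open>
  For uniqueness of the label, let \<open>(c, d)\<close> be the pair of another candidate. The join condition puts
  \<open>(c, d)\<close> in \<open>R\<close> but not in the lower cover, so \<open>c\<close> is a translate of \<open>a\<close> and \<open>d\<close> is at least the
  corresponding translate of \<open>b\<close>. If it were larger, the meet condition would leave this translate of
  \<open>(a, b)\<close> in the lower cover.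
\<close>

lemma cover_label_wall:
  assumes R: "bracket_rel R" and W: "wall R a b"
  shows "cover_label (CTam312 n) (tito_of (R \<inter> kappa_rel a b)) (tito_of R) = tito_of (join_irred_rel a b)"
proof -
  let ?J = "join_irred_rel a b" and ?X = "R \<inter> kappa_rel a b"
  have ab: "a < b" "b \<le> a + n" "(a, b) \<in> R" using W wall_length[OF R W] by (auto simp: wall_def)
  note J = bracket_join_irred[OF ab(1,2)]
  have X: "bracket_rel ?X" by (intro bracket_Int R bracket_kappa)
  show ?thesis
    unfolding cover_label_def
  proof (rule the_equality, intro conjI)
    show "join_irreducible (CTam312 n) (tito_of ?J)"
      using join_irreducible_iff[OF J] ab by blast
    show "is_join (CTam312 n) (tito_of ?J) (tito_of ?X) (tito_of R)"
      unfolding is_join_iff[OF J X R]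
      using above_wall[OF R W] join_irred_subset_iff[OF ab(1,2)] ab R by simp
    show "is_meet (CTam312 n) (kappa (CTam312 n) (tito_of ?J)) (tito_of R) (tito_of ?X)"
      unfolding kappa_join_irred[OF ab(1,2)] is_meet_iff[OF bracket_kappa R X] by blast
  next
    fix j
    assume j: "join_irreducible (CTam312 n) j \<and> is_join (CTam312 n) j (tito_of ?X) (tito_of R) \<and>
      is_meet (CTam312 n) (kappa (CTam312 n) j) (tito_of R) (tito_of ?X)"
    then obtain J' where "bracket_rel J'" "j = tito_of J'"
      by (auto simp: join_irreducible_def elim: carrier_cases)
    then obtain c d where cd: "c < d" "d \<le> c + n" and j_eq: "j = tito_of (join_irred_rel c d)"
      using j join_irreducible_iff by blast
    note J' = bracket_join_irred[OF cd]
    have join: "join_irred_rel c d \<subseteq> R" "\<And>Z. bracket_rel Z \<Longrightarrow> join_irred_rel c d \<union> ?X \<subseteq> Z \<Longrightarrow> R \<subseteq> Z"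
      using j j_eq is_join_iff[OF J' X R] by simp_all
    have meet: "?X = kappa_rel c d \<inter> R"
      using j is_meet_iff[OF bracket_kappa R X] by (simp add: j_eq kappa_join_irred[OF cd])
    have cdR: "(c, d) \<in> R" using join(1) join_irred_subset_iff[OF cd R] by blast
    have "(c, d) \<notin> kappa_rel a b"
    proof
      assume "(c, d) \<in> kappa_rel a b"
      then have "join_irred_rel c d \<subseteq> ?X" using join_irred_subset_iff[OF cd X] cdR by blast
      then have "R \<subseteq> ?X" using join(2)[OF X] by blast
      then show False using ab pair_notin_kappa by blast
    qed
    then obtain k where k: "c = a + k * n" "b + k * n \<le> d"
      using wall_outside_kappa[OF R W cdR] by blast
    have "b + k * n = d"
    proof (rule ccontr)
      assume "b + k * n \<noteq> d"
      then have less: "c < b + k * n" "b + k * n < d" using k ab by auto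
      have "b + k * n < d + l * n" if "c + l * n \<le> c" "c < d + l * n" for l
        using window_unique[OF cd(2), of l c 0] that cd less by simp
      then have "(c, b + k * n) \<in> kappa_rel c d" using less by (simp add: kappa_rel_def)
      moreover have "(c, b + k * n) \<in> R" using ab k bracket_shift[OF R] by blast
      ultimately have "(a + k * n, b + k * n) \<in> kappa_rel a b" using meet k by blast
      then show False using bracket_shift[OF bracket_kappa] pair_notin_kappa[OF ab(1)] by blast
    qed
    then show "j = tito_of ?J" using j_eq k(1) join_irred_shift by metis
  qed
qed

lemma down_labels_tito_of:
  assumes R: "bracket_rel R"
  shows "down_labels (CTam312 n) (tito_of R) = {tito_of (join_irred_rel a b) | a b. wall R a b}"
proof (intro equalityI subsetI)
  fix l assume "l \<in> down_labels (CTam312 n) (tito_of R)"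
  then obtain x where cov: "covered_by (CTam312 n) x (tito_of R)" "l = cover_label (CTam312 n) x (tito_of R)"
    by (auto simp: down_labels_def)
  then obtain X where "bracket_rel X" "x = tito_of X"
    by (auto simp: covered_by_def elim: carrier_cases)
  then obtain a b where "wall R a b" "x = tito_of (R \<inter> kappa_rel a b)"
    using cov lower_covers[OF _ R] by blast
  then show "l \<in> {tito_of (join_irred_rel a b) | a b. wall R a b}"
    using cov cover_label_wall[OF R] by blast
next
  fix l assume "l \<in> {tito_of (join_irred_rel a b) | a b. wall R a b}"
  then obtain a b where W: "wall R a b" "l = tito_of (join_irred_rel a b)" by blast
  have "bracket_rel (R \<inter> kappa_rel a b)" by (intro bracket_Int R bracket_kappa)
  then have "covered_by (CTam312 n) (tito_of (R \<inter> kappa_rel a b)) (tito_of R)"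
    using lower_covers[OF _ R] W by blast
  then show "l \<in> down_labels (CTam312 n) (tito_of R)"
    using cover_label_wall[OF R W(1)] W unfolding down_labels_def by force
qed

lemma up_labels_tito_of:
  assumes V: "bracket_rel V"
  shows "up_labels (CTam312 n) (tito_of V) = {tito_of (join_irred_rel a b) | a b. up_wall V a b}"
proof (intro equalityI subsetI)
  fix l assume "l \<in> up_labels (CTam312 n) (tito_of V)"
  then obtain y where cov: "covered_by (CTam312 n) (tito_of V) y" "l = cover_label (CTam312 n) (tito_of V) y"
    by (auto simp: up_labels_def)
  then obtain Y where Y: "bracket_rel Y" "y = tito_of Y"
    by (auto simp: covered_by_def elim: carrier_cases)
  then obtain a b where W: "wall Y a b" "V = Y \<inter> kappa_rel a b"
    using cov lower_covers[OF V] by blast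
  then have "l = tito_of (join_irred_rel a b)" using cov cover_label_wall[OF Y(1)] Y by simp
  then show "l \<in> {tito_of (join_irred_rel a b) | a b. up_wall V a b}"
    using wall_up_wall[OF Y(1) W(1)] W by blast
next
  fix l assume "l \<in> {tito_of (join_irred_rel a b) | a b. up_wall V a b}"
  then obtain a b where W: "up_wall V a b" "l = tito_of (join_irred_rel a b)" by blast
  obtain Y where Y: "bracket_rel Y" "wall Y a b" "V = Y \<inter> kappa_rel a b"
    using up_wall_cover[OF V W(1)] by blast
  then have "covered_by (CTam312 n) (tito_of V) (tito_of Y)"
    using lower_covers[OF V] by blast
  then show "l \<in> up_labels (CTam312 n) (tito_of V)"
    using cover_label_wall[OF Y(1,2)] W Y(3) unfolding up_labels_def by force
qed

text \<open>
  Equal join-irreducible elements have equal kappa images, so \<open>up_walls_generate\<close> applies without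
  recovering the pairs \<open>(a, b)\<close> from the labels.
\<close>

lemma inj_up_labels: "inj_on (up_labels (CTam312 n)) (carrier (CTam312 n))"
proof -
  have sub: "Z \<subseteq> V" if VZ: "bracket_rel V" "bracket_rel Z"
    "up_labels (CTam312 n) (tito_of V) = up_labels (CTam312 n) (tito_of Z)" for V Z
  proof (rule up_walls_generate[OF VZ(1,2)])
    fix a b assume W: "up_wall V a b"
    then have "tito_of (join_irred_rel a b) \<in> up_labels (CTam312 n) (tito_of Z)"
      using up_labels_tito_of[OF VZ(1)] VZ(3) by blast
    then obtain c d where W': "up_wall Z c d"
      and eq: "tito_of (join_irred_rel a b) = tito_of (join_irred_rel c d)"
      using up_labels_tito_of[OF VZ(2)] by auto
    have ab: "a < b" "b \<le> a + n" and cd: "c < d" "d \<le> c + n"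
      using W W' by (auto simp: up_wall_def)
    have "kappa_rel a b = kappa_rel c d"
      using kappa_join_irred[OF ab] kappa_join_irred[OF cd] eq tito_of_eq_iff bracket_kappa by metis
    then show "Z \<subseteq> kappa_rel a b"
      using subset_kappa[OF cd VZ(2)] W' by (auto simp: up_wall_def)
  qed
  show ?thesis
  proof (rule inj_onI)
    fix u v
    assume "u \<in> carrier (CTam312 n)" "v \<in> carrier (CTam312 n)"
      and eq: "up_labels (CTam312 n) u = up_labels (CTam312 n) v"
    then obtain U V where "bracket_rel U" "u = tito_of U" "bracket_rel V" "v = tito_of V"
      by (auto elim!: carrier_cases)
    then show "u = v" using sub[of U V] sub[of V U] eq by auto
  qed
qed

lemma inj_down_labels: "inj_on (down_labels (CTam312 n)) (carrier (CTam312 n))"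
proof -
  have sub: "R \<subseteq> Z" if RZ: "bracket_rel R" "bracket_rel Z"
    "down_labels (CTam312 n) (tito_of R) = down_labels (CTam312 n) (tito_of Z)" for R Z
  proof (rule walls_generate[OF RZ(1,2)])
    fix a b assume W: "wall R a b"
    then have "tito_of (join_irred_rel a b) \<in> down_labels (CTam312 n) (tito_of Z)"
      using down_labels_tito_of[OF RZ(1)] RZ(3) by blast
    then obtain c d where W': "wall Z c d"
      and eq: "tito_of (join_irred_rel a b) = tito_of (join_irred_rel c d)"
      using down_labels_tito_of[OF RZ(2)] by auto
    have ab: "a < b" "b \<le> a + n" and cd: "c < d" "d \<le> c + n"
      using W W' wall_length[OF RZ(1) W] wall_length[OF RZ(2) W'] by (auto simp: wall_def)
    have "join_irred_rel a b = join_irred_rel c d"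
      using eq tito_of_eq_iff bracket_join_irred[OF ab] bracket_join_irred[OF cd] by blast
    moreover have "join_irred_rel c d \<subseteq> Z"
      using join_irred_subset_iff[OF cd RZ(2)] W' by (simp add: wall_def)
    ultimately show "(a, b) \<in> Z" using join_irred_subset_iff[OF ab RZ(2)] by blast
  qed
  show ?thesis
  proof (rule inj_onI)
    fix u v
    assume "u \<in> carrier (CTam312 n)" "v \<in> carrier (CTam312 n)"
      and eq: "down_labels (CTam312 n) u = down_labels (CTam312 n) v"
    then obtain U V where "bracket_rel U" "u = tito_of U" "bracket_rel V" "v = tito_of V"
      by (auto elim!: carrier_cases)
    then show "u = v" using sub[of U V] sub[of V U] eq by auto
  qed
qed

text \<open>
  Bracket functions are determined by their values on one period, and there each value is either less
  than \<open>2 * n\<close> or infinite.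
\<close>

lemma finite_carrier: "finite (carrier (CTam312 n))"
proof -
  \<comment> \<open>The pair \<open>(x, x + n)\<close> in the box detects the value \<open>\<infinity>\<close> at \<open>x\<close>.\<close>
  define box where "box = {0..<n} \<times> {0..2 * n}"
  have sub: "R \<subseteq> S" if R: "bracket_rel R" and S: "bracket_rel S" and eq: "R \<inter> box = S \<inter> box" for R S
  proof clarify
    fix x y assume xy: "(x, y) \<in> R"
    define k where "k = x div n"
    define x' y' where "x' = x mod n" and "y' = y - k * n"
    have xk: "x = x' + k * n" "y = y' + k * n" by (simp_all add: x'_def y'_def k_def)
    have x': "0 \<le> x'" "x' < n" using n_pos by (simp_all add: x'_def)
    have R': "(x', y') \<in> R" using xy xk bracket_shift[OF R] by metis
    have "(x', y') \<in> S"
    proof (cases "y' \<le> x' + n")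
      case True
      then have "(x', y') \<in> box" using x' bracket_le[OF R R'] by (auto simp: box_def)
      then show ?thesis using eq R' by blast
    next
      case False
      then have "(x', x' + n) \<in> R" using bracket_convex[OF R R'] n_pos by simp
      moreover have "(x', x' + n) \<in> box" using x' by (auto simp: box_def)
      ultimately have "(x', x' + n) \<in> S" using eq by blast
      then show ?thesis using unbounded_bracket[OF S] bracket_le[OF R R'] by blast
    qed
    then show "(x, y) \<in> S" using xk bracket_shift[OF S] by metis
  qed
  have "inj_on (\<lambda>R. R \<inter> box) {R. bracket_rel R}"
    using sub by (intro inj_onI) (metis mem_Collect_eq subset_antisym)
  moreover have "finite ((\<lambda>R. R \<inter> box) ` {R. bracket_rel R})"
    by (rule finite_subset[of _ "Pow box"]) (auto simp: box_def)
  ultimately have "finite {R. bracket_rel R}" by (metis finite_imageD)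
  then show ?thesis by (simp add: carrier_eq)
qed

text \<open>
  The map is injective because the lower labels are, and it is bijective because the lattice is
  finite.
\<close>

theorem rowmotion_tito_of:
  assumes "bracket_rel R"
  shows "rowmotion (CTam312 n) (tito_of R) = tito_of (row_rel R)"
proof -
  let ?C = "carrier (CTam312 n)"
  define f where "f = restrict (\<lambda>r. tito_of (row_rel (bracket_of r))) ?C"
  have f: "f (tito_of R) = tito_of (row_rel R)" if "bracket_rel R" for R
    using that tito_of_in_carrier bracket_of_tito_of by (simp add: f_def)
  have labels: "down_labels (CTam312 n) u = up_labels (CTam312 n) (f u)" if "u \<in> ?C" for u
  proof -
    obtain U where U: "bracket_rel U" "u = tito_of U" using \<open>u \<in> ?C\<close> by (rule carrier_cases)
    then show ?thesis
      by (simp add: f down_labels_tito_of up_labels_tito_of bracket_row up_wall_row_iff)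
  qed
  have maps: "f ` ?C \<subseteq> ?C"
    using f bracket_row tito_of_in_carrier by (auto simp: carrier_eq)
  have "inj_on f ?C"
    using labels inj_onD[OF inj_down_labels] by (intro inj_onI) metis
  then have "bij_betw f ?C ?C"
    using endo_inj_surj[OF finite_carrier maps] by (simp add: bij_betw_def)
  then have "rowmotion (CTam312 n) = f"
    using labels inj_up_labels by (intro rowmotion_eqI) (auto simp: f_def)
  then show ?thesis using f assms by simp
qed

end

section \<open>Noncrossing partitions and the Kreweras complement\<close>

lemma same_block_quotient:
  assumes "equiv UNIV E"
  shows "same_block (UNIV // E) x y \<longleftrightarrow> (x, y) \<in> E"
proof
  assume "same_block (UNIV // E) x y"
  then show "(x, y) \<in> E"
    using quotient_eq_iff[OF assms] by (fastforce simp: same_block_def)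
next
  assume "(x, y) \<in> E"
  then have "x \<in> E `` {x}" "y \<in> E `` {x}" using equiv_class_self[OF assms] by auto
  then show "same_block (UNIV // E) x y" unfolding same_block_def by (blast intro: quotientI)
qed

lemma block_unique:
  "partition_on A P \<Longrightarrow> X \<in> P \<Longrightarrow> Y \<in> P \<Longrightarrow> x \<in> X \<Longrightarrow> x \<in> Y \<Longrightarrow> X = Y"
  using partition_onD2 disjointD by blast

lemma same_block_sym: "same_block \<rho> x y \<longleftrightarrow> same_block \<rho> y x"
  unfolding same_block_def by blast

lemma same_block_refl: "partition_on UNIV \<rho> \<Longrightarrow> same_block \<rho> x x"
  unfolding same_block_def partition_on_def by blast

lemma same_block_trans:
  assumes "partition_on UNIV \<rho>" "same_block \<rho> x y" "same_block \<rho> y z"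
  shows "same_block \<rho> x z"
  using assms block_unique unfolding same_block_def by metis

lemma refines_iff_same_block:
  assumes P: "partition_on UNIV P" and Q: "partition_on UNIV Q"
  shows "refines UNIV P Q \<longleftrightarrow> (\<forall>x y. same_block P x y \<longrightarrow> same_block Q x y)"
proof
  assume "refines UNIV P Q"
  then show "\<forall>x y. same_block P x y \<longrightarrow> same_block Q x y"
    unfolding refines_def same_block_def by blast
next
  assume same: "\<forall>x y. same_block P x y \<longrightarrow> same_block Q x y"
  have "\<exists>Y\<in>Q. X \<subseteq> Y" if X: "X \<in> P" for X
  proof -
    obtain x where "x \<in> X" using X partition_onD3[OF P] by fastforce
    then obtain Y where Y: "Y \<in> Q" "x \<in> Y" using same_block_refl[OF Q] unfolding same_block_def by blast
    have "y \<in> Y" if "y \<in> X" for y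
    proof -
      have "same_block Q x y" using same X \<open>x \<in> X\<close> that unfolding same_block_def by blast
      then show ?thesis using Y block_unique[OF Q] unfolding same_block_def by blast
    qed
    then show ?thesis using Y by blast
  qed
  then show "refines UNIV P Q" using P Q unfolding refines_def by blast
qed

lemma partition_on_interleave:
  assumes "partition_on UNIV \<rho>" "partition_on UNIV \<sigma>"
  shows "partition_on UNIV (interleave \<rho> \<sigma>)"
proof (rule partition_onI)
  have "z \<in> \<Union> (interleave \<rho> \<sigma>)" for z
  proof (cases z)
    case (Pair x t)
    obtain A B where "A \<in> \<rho>" "x \<in> A" "B \<in> \<sigma>" "x \<in> B"
      using partition_onD1[OF assms(1)] partition_onD1[OF assms(2)] by blast
    then show ?thesis by (cases t) (auto simp: interleave_def Pair)
  qed
  then show "\<Union> (interleave \<rho> \<sigma>) = UNIV" by blast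
  have part: "partition_on UNIV (if t then \<sigma> else \<rho>)" for t using assms by simp
  have shape: "\<exists>A t. p = A \<times> {t} \<and> A \<in> (if t then \<sigma> else \<rho>)" if p: "p \<in> interleave \<rho> \<sigma>" for p
  proof -
    consider A where "A \<in> \<rho>" "p = A \<times> {False}" | A where "A \<in> \<sigma>" "p = A \<times> {True}"
      using p unfolding interleave_def by blast
    then show ?thesis by cases (metis (full_types))+
  qed
  show "disjnt p q" if pq: "p \<in> interleave \<rho> \<sigma>" "q \<in> interleave \<rho> \<sigma>" "p \<noteq> q" for p q
  proof (rule ccontr)
    assume "\<not> disjnt p q"
    then obtain x t where "(x, t) \<in> p" "(x, t) \<in> q" unfolding disjnt_iff by fast
    moreover from this obtain A B where "p = A \<times> {t}" "A \<in> (if t then \<sigma> else \<rho>)"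
      "q = B \<times> {t}" "B \<in> (if t then \<sigma> else \<rho>)"
      using shape[OF pq(1)] shape[OF pq(2)] by blast
    ultimately show False using pq(3) block_unique[OF part, of A t B x] by simp
  qed
  show "{} \<notin> interleave \<rho> \<sigma>"
    using shape[of "{}"] partition_onD3[OF part] by (metis Times_empty insert_not_empty)
qed

lemma same_block_interleave:
  "same_block (interleave \<rho> \<sigma>) (x, False) (y, False) \<longleftrightarrow> same_block \<rho> x y"
  "same_block (interleave \<rho> \<sigma>) (x, True) (y, True) \<longleftrightarrow> same_block \<sigma> x y"
  "\<not> same_block (interleave \<rho> \<sigma>) (x, False) (y, True)"
  "\<not> same_block (interleave \<rho> \<sigma>) (x, True) (y, False)"
  unfolding same_block_def interleave_def by auto

lemma noncrossing_partition_on: "noncrossing \<rho> \<Longrightarrow> partition_on UNIV \<rho>"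
  unfolding noncrossing_def by blast

lemma noncrossingD:
  "noncrossing \<rho> \<Longrightarrow> x1 < x2 \<Longrightarrow> x2 < x3 \<Longrightarrow> x3 < x4 \<Longrightarrow> same_block \<rho> x1 x3 \<Longrightarrow> same_block \<rho> x2 x4 \<Longrightarrow>
    same_block \<rho> x1 x2"
  unfolding noncrossing_def by blast

text \<open>
  A block of \<open>\<rho>\<close> crosses a block of \<open>\<sigma>\<close> only if it has elements inside and outside some \<open>{i<..j}\<close>
  with \<open>i\<close> and \<open>j\<close> in the latter: the integers between the copies of \<open>i\<close> and \<open>j\<close> are those in
  \<open>{i<..j}\<close>. The next lemma is the converse.
\<close>

lemma noncrossing_interleave:
  assumes \<rho>: "noncrossing \<rho>" and \<sigma>: "noncrossing \<sigma>"
    and saturated: "\<And>i j x y. i < j \<Longrightarrow> same_block \<sigma> i j \<Longrightarrow> same_block \<rho> x y \<Longrightarrow>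
      x \<in> {i<..j} \<longleftrightarrow> y \<in> {i<..j}"
  shows "noncrossing (interleave \<rho> \<sigma>)"
  unfolding noncrossing_def
proof (intro conjI allI impI)
  show "partition_on UNIV (interleave \<rho> \<sigma>)"
    using \<rho> \<sigma> by (intro partition_on_interleave noncrossing_partition_on)
  fix x1 x2 x3 x4
  assume cross: "x1 < x2 \<and> x2 < x3 \<and> x3 < x4 \<and> same_block (interleave \<rho> \<sigma>) x1 x3 \<and>
    same_block (interleave \<rho> \<sigma>) x2 x4"
  obtain a1 t1 a2 t2 a3 t3 a4 t4 where eqs: "x1 = (a1, t1)" "x2 = (a2, t2)" "x3 = (a3, t3)" "x4 = (a4, t4)"
    by (metis surj_pair)
  have "t3 = t1" "t4 = t2" using cross same_block_interleave eqs by metis+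
  show "same_block (interleave \<rho> \<sigma>) x1 x2"
  proof (cases t1; cases t2)
    assume t: "t1" "t2"
    then show ?thesis using cross \<open>t3 = t1\<close> \<open>t4 = t2\<close> noncrossingD[OF \<sigma>, of a1 a2 a3 a4]
      by (simp add: eqs same_block_interleave)
  next
    assume t: "\<not> t1" "\<not> t2"
    then show ?thesis using cross \<open>t3 = t1\<close> \<open>t4 = t2\<close> noncrossingD[OF \<rho>, of a1 a2 a3 a4]
      by (simp add: eqs same_block_interleave)
  next
    assume t: "t1" "\<not> t2"
    then have "a1 < a2" "a2 \<le> a3" "a3 < a4" "same_block \<sigma> a1 a3" "same_block \<rho> a2 a4"
      using cross \<open>t3 = t1\<close> \<open>t4 = t2\<close> by (auto simp: eqs same_block_interleave)
    then show ?thesis using saturated[of a1 a3 a2 a4] by simp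
  next
    assume t: "\<not> t1" "t2"
    then have "a1 \<le> a2" "a2 < a3" "a3 \<le> a4" "same_block \<rho> a1 a3" "same_block \<sigma> a2 a4"
      using cross \<open>t3 = t1\<close> \<open>t4 = t2\<close> by (auto simp: eqs same_block_interleave)
    then show ?thesis using saturated[of a2 a4 a1 a3] by simp
  qed
qed

lemma interleave_saturated:
  assumes nc: "noncrossing (interleave \<rho> \<sigma>)"
    and ij: "i < j" "same_block \<sigma> i j" and xy: "same_block \<rho> x y"
  shows "x \<in> {i<..j} \<longleftrightarrow> y \<in> {i<..j}"
proof -
  have imp: "y \<in> {i<..j}" if xy: "same_block \<rho> x y" and x: "x \<in> {i<..j}" for x y
  proof (rule ccontr)
    assume "y \<notin> {i<..j}"
    then consider "y \<le> i" | "j < y" by force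
    then show False
    proof cases
      case 1
      moreover have "same_block \<rho> y x" using xy same_block_sym by metis
      ultimately show False
        using noncrossingD[OF nc, of "(y, False)" "(i, True)" "(x, False)" "(j, True)"] ij x
        by (simp add: same_block_interleave)
    next
      case 2
      then show False
        using noncrossingD[OF nc, of "(i, True)" "(x, False)" "(j, True)" "(y, False)"] ij x xy
        by (simp add: same_block_interleave)
    qed
  qed
  show ?thesis using imp[of x y] imp[of y x] xy same_block_sym by metis
qed

lemma krew_eqI:
  assumes \<rho>: "noncrossing \<rho>" and \<sigma>: "noncrossing \<sigma>"
    and saturated: "\<And>i j. i < j \<Longrightarrow> same_block \<sigma> i j \<longleftrightarrow>
      (\<forall>x y. same_block \<rho> x y \<longrightarrow> (x \<in> {i<..j} \<longleftrightarrow> y \<in> {i<..j}))"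
  shows "krew \<rho> = \<sigma>"
proof -
  note part = noncrossing_partition_on[OF \<sigma>]
  have nc: "noncrossing (interleave \<rho> \<sigma>)"
    using noncrossing_interleave[OF \<rho> \<sigma>] saturated by blast
  have coarsest: "refines UNIV \<tau> \<sigma>" if \<tau>: "partition_on UNIV \<tau>" "noncrossing (interleave \<rho> \<tau>)" for \<tau>
    unfolding refines_iff_same_block[OF \<tau>(1) part]
  proof (intro allI impI)
    have less: "same_block \<sigma> i j" if "i < j" "same_block \<tau> i j" for i j
      using saturated[OF \<open>i < j\<close>] interleave_saturated[OF \<tau>(2) that] by blast
    fix i j assume "same_block \<tau> i j"
    then show "same_block \<sigma> i j"
      using less[of i j] less[of j i] same_block_refl[OF part] same_block_sym
      by (metis linorder_less_linear)
  qed
  show ?thesis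
    unfolding krew_def
  proof (rule the_equality)
    show "partition_on UNIV \<sigma> \<and> noncrossing (interleave \<rho> \<sigma>) \<and>
      (\<forall>\<tau>. partition_on UNIV \<tau> \<and> noncrossing (interleave \<rho> \<tau>) \<longrightarrow> refines UNIV \<tau> \<sigma>)"
      using part nc coarsest by blast
    fix \<sigma>'
    assume "partition_on UNIV \<sigma>' \<and> noncrossing (interleave \<rho> \<sigma>') \<and>
      (\<forall>\<tau>. partition_on UNIV \<tau> \<and> noncrossing (interleave \<rho> \<tau>) \<longrightarrow> refines UNIV \<tau> \<sigma>')"
    then have "refines UNIV \<sigma>' \<sigma>" "refines UNIV \<sigma> \<sigma>'" using part nc coarsest by simp_all
    then show "\<sigma>' = \<sigma>" by (rule refines_asym)
  qed
qed

context bracket_period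
begin

section \<open>Fibres of bracket functions\<close>

text \<open>
  The condition \<open>h(x) = h(y)\<close>. Comparing the two sides only at \<open>d \<ge> max x y\<close> suffices: at
  \<open>d = max x y\<close> it forces \<open>h(x)\<close> and \<open>h(y)\<close> to be at least \<open>max x y\<close>.
\<close>

definition block_rel :: "int rel \<Rightarrow> int rel" where
  "block_rel R = {(x, y). \<forall>d. x \<le> d \<and> y \<le> d \<longrightarrow> ((x, d) \<in> R \<longleftrightarrow> (y, d) \<in> R)}"

lemma block_rel_bracket:
  assumes R: "bracket_rel R" and "(x, y) \<in> block_rel R" "x \<le> y"
  shows "(x, y) \<in> R"
  using assms bracket_refl[OF R, of y] unfolding block_rel_def by blast

lemma equiv_block_rel:
  assumes R: "bracket_rel R"
  shows "equiv UNIV (block_rel R)"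
proof (rule equivI)
  show "sym (block_rel R)" by (rule symI) (auto simp: block_rel_def)
  show "trans (block_rel R)"
  proof (rule transI)
    fix x y z assume xy: "(x, y) \<in> block_rel R" and yz: "(y, z) \<in> block_rel R"
    have "(x, d) \<in> R \<longleftrightarrow> (z, d) \<in> R" if d: "x \<le> d" "z \<le> d" for d
    proof (cases "y \<le> d")
      case True
      then show ?thesis using xy yz d unfolding block_rel_def by blast
    next
      case False
      have "(x, y) \<in> R" "(z, y) \<in> R"
        using xy yz False d bracket_refl[OF R, of y] unfolding block_rel_def by auto
      then show ?thesis using bracket_convex[OF R] False d by auto
    qed
    then show "(x, z) \<in> block_rel R" unfolding block_rel_def by blast
  qed
qed (auto simp: block_rel_def refl_on_def)

lemma block_rel_sym: "(x, y) \<in> block_rel R \<longleftrightarrow> (y, x) \<in> block_rel R"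
  unfolding block_rel_def by blast

lemma wall_same_block:
  assumes R: "bracket_rel R" and W: "wall R a b"
  shows "(a, b) \<in> block_rel R"
  using W bracket_trans[OF R] unfolding block_rel_def wall_def by blast

text \<open>
  Any two elements of a fibre are joined by a chain of walls. This is used for two relations \<open>E\<close>:
  sharing a block of a given partition, and lying on the same side of \<open>{i<..j}\<close>.
\<close>

lemma walls_generate_blocks:
  assumes R: "bracket_rel R"
    and refl: "\<And>x. E x x" and sym: "\<And>x y. E x y \<Longrightarrow> E y x" and trans: "\<And>x y z. E x y \<Longrightarrow> E y z \<Longrightarrow> E x z"
    and walls: "\<And>a b. wall R a b \<Longrightarrow> E a b"
    and xy: "(x, y) \<in> block_rel R"
  shows "E x y"
proof -
  have less: "E x y" if "x \<le> y" "(x, y) \<in> block_rel R" for x y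
    using that
  proof (induction "nat (y - x)" arbitrary: x rule: less_induct)
    case less
    show ?case
    proof (cases "x = y")
      case True
      then show ?thesis using refl by simp
    next
      case False
      then have "x < y" using less.prems by simp
      have "(y, e) \<in> R" if "y \<le> e" "(x, e) \<in> R" for e
        using less.prems that \<open>x < y\<close> unfolding block_rel_def by auto
      then obtain b where b: "wall R x b" "b \<le> y"
        using next_in_block[OF R block_rel_bracket[OF R less.prems(2,1)] \<open>x < y\<close>] by blast
      have "(b, x) \<in> block_rel R" using wall_same_block[OF R b(1)] block_rel_sym by blast
      then have "(b, y) \<in> block_rel R"
        using less.prems(2) equiv_block_rel[OF R] by (meson equivE transE)
      moreover have "x < b" using b by (simp add: wall_def)
      ultimately have "E b y" using less.hyps[of b] b by simp
      then show ?thesis using walls[OF b(1)] trans by blast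
    qed
  qed
  show ?thesis using less[of x y] less[of y x] xy block_rel_sym sym by (meson linear)
qed

text \<open>
  If \<open>x1 < x2 < x3 < x4\<close> with \<open>h(x1) = h(x3)\<close> and \<open>h(x2) = h(x4)\<close>, then \<open>x2 \<le> h(x1)\<close> and
  \<open>x3 \<le> h(x2)\<close>, so \<open>h(x2) \<le> h(x1)\<close> and \<open>h(x1) = h(x3) \<le> h(x2)\<close>.
\<close>

lemma noncrossing_blocks:
  assumes R: "bracket_rel R"
  shows "noncrossing (UNIV // block_rel R)"
  unfolding noncrossing_def same_block_quotient[OF equiv_block_rel[OF R]]
proof (intro conjI allI impI)
  show "partition_on UNIV (UNIV // block_rel R)"
    by (rule partition_on_quotient[OF equiv_block_rel[OF R]])
  fix x1 x2 x3 x4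
  assume *: "x1 < x2 \<and> x2 < x3 \<and> x3 < x4 \<and> (x1, x3) \<in> block_rel R \<and> (x2, x4) \<in> block_rel R"
  then have R13: "(x1, x3) \<in> R" and R24: "(x2, x4) \<in> R"
    using block_rel_bracket[OF R] by simp_all
  have R12: "(x1, x2) \<in> R" using bracket_convex[OF R R13] * by simp
  have R23: "(x2, x3) \<in> R" using bracket_convex[OF R R24] * by simp
  have "(x2, d) \<in> R" if d: "x2 \<le> d" "(x1, d) \<in> R" for d
  proof (cases "d \<le> x3")
    case True
    then show ?thesis using bracket_convex[OF R R23] d by simp
  next
    case False
    then have "(x3, d) \<in> R" using * d unfolding block_rel_def by auto
    then show ?thesis using R23 bracket_trans[OF R] by blast
  qed
  then show "(x1, x2) \<in> block_rel R"
    using R12 bracket_trans[OF R] unfolding block_rel_def by blast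
qed

lemma block_rel_shift:
  assumes R: "bracket_rel R"
  shows "(x + n, y + n) \<in> block_rel R \<longleftrightarrow> (x, y) \<in> block_rel R"
proof -
  have "(\<forall>d. x + n \<le> d \<and> y + n \<le> d \<longrightarrow> ((x + n, d) \<in> R \<longleftrightarrow> (y + n, d) \<in> R)) \<longleftrightarrow>
    (\<forall>d. x + n \<le> d + n \<and> y + n \<le> d + n \<longrightarrow> ((x + n, d + n) \<in> R \<longleftrightarrow> (y + n, d + n) \<in> R))"
    by (metis diff_add_cancel)
  then show ?thesis using bracket_shift_n[OF R] by (simp add: block_rel_def)
qed

text \<open>
  If \<open>h(a) \<ge> b > a\<close>, an element strictly between \<open>b\<close> and \<open>a\<close> in the total order is either some \<open>c\<close> with
  \<open>a < c < b\<close> and \<open>h(c) \<ge> b\<close>, or some \<open>c\<close> with \<open>h(b) < c \<le> h(a)\<close>. Walls exclude just these two cases;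
  an element \<open>c < a\<close> would need \<open>h(c) \<ge> b\<close> and \<open>h(c) < a\<close>.
\<close>

lemma lower_wall_iff:
  assumes R: "bracket_rel R" and "a < b"
  shows "(b, a) \<in> tito_of R \<and>
      \<not> (\<exists>c. c \<noteq> a \<and> c \<noteq> b \<and> (b, c) \<in> tito_of R \<and> (c, a) \<in> tito_of R) \<longleftrightarrow> wall R a b"
proof (intro iffI conjI notI)
  assume *: "(b, a) \<in> tito_of R \<and>
    \<not> (\<exists>c. c \<noteq> a \<and> c \<noteq> b \<and> (b, c) \<in> tito_of R \<and> (c, a) \<in> tito_of R)"
  then have ab: "(a, b) \<in> R" using \<open>a < b\<close> by (simp add: tito_of_def)
  show "wall R a b"
    unfolding wall_def
  proof (intro conjI allI impI)
    show "a < b" "(a, b) \<in> R" by fact+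
    show "(c, b) \<notin> R" if c: "a < c \<and> c < b" for c
    proof
      assume "(c, b) \<in> R"
      then have "(b, c) \<in> tito_of R" "(c, a) \<in> tito_of R"
        using c bracket_convex[OF R ab] by (simp_all add: tito_of_def)
      moreover have "c \<noteq> a" "c \<noteq> b" using c by auto
      ultimately show False using * by blast
    qed
    show "(b, d) \<in> R" if d: "b \<le> d" "(a, d) \<in> R" for d
    proof (rule ccontr)
      assume "(b, d) \<notin> R"
      then have "b \<noteq> d" using bracket_refl[OF R] by blast
      then have "(b, d) \<in> tito_of R" "(d, a) \<in> tito_of R"
        using d \<open>a < b\<close> \<open>(b, d) \<notin> R\<close> by (simp_all add: tito_of_def)
      moreover have "d \<noteq> a" using d \<open>a < b\<close> by simp
      ultimately show False using * \<open>b \<noteq> d\<close> by blast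
    qed
  qed
next
  assume W: "wall R a b"
  show "(b, a) \<in> tito_of R" using W by (simp add: wall_def tito_of_def)
  assume "\<exists>c. c \<noteq> a \<and> c \<noteq> b \<and> (b, c) \<in> tito_of R \<and> (c, a) \<in> tito_of R"
  then obtain c where c: "c \<noteq> a" "c \<noteq> b" "(b, c) \<in> tito_of R" "(c, a) \<in> tito_of R" by blast
  consider "c < a" | "a < c" "c < b" | "b < c" using c by linarith
  then show False
  proof cases
    case 1
    then show False using c \<open>a < b\<close> bracket_convex[OF R, of c b a] by (simp add: tito_of_def)
  next
    case 2
    then show False using c W by (simp add: tito_of_def wall_def)
  next
    case 3
    then show False using c W by (simp add: tito_of_def wall_def)
  qed
qed

lemma Union_lower_walls:
  assumes R: "bracket_rel R"
  shows "\<Union> (lower_walls n (tito_of R)) = {(a, b). wall R a b}"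
proof -
  have "wall R a b" if ab: "(a, b) \<in> \<Union> (lower_walls n (tito_of R))" for a b
  proof -
    obtain I c d where I: "I \<in> reflection_indices n" "(a, b) \<in> I" "(c, d) \<in> I"
      and cd: "(d, c) \<in> tito_of R \<and>
        \<not> (\<exists>e. e \<noteq> c \<and> e \<noteq> d \<and> (d, e) \<in> tito_of R \<and> (e, c) \<in> tito_of R)"
      using ab unfolding lower_walls_def by blast
    obtain a0 b0 k l where "a0 < b0" and eqs: "a = a0 + k * n" "b = b0 + k * n" "c = a0 + l * n" "d = b0 + l * n"
      using I unfolding reflection_indices_def translation_class_def by blast
    then have "wall R c d" using lower_wall_iff[OF R, of c d] cd by simp
    then show ?thesis unfolding eqs wall_shift[OF R] .
  qed
  moreover have "(a, b) \<in> \<Union> (lower_walls n (tito_of R))" if W: "wall R a b" for a b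
  proof -
    have "a < b" using W by (simp add: wall_def)
    have "(a, b) \<in> translation_class n a b"
      unfolding translation_class_def by (auto intro: exI[of _ 0])
    moreover have "translation_class n a b \<in> reflection_indices n"
      unfolding reflection_indices_def using \<open>a < b\<close> by blast
    ultimately show ?thesis
      using lower_wall_iff[OF R \<open>a < b\<close>] W unfolding lower_walls_def by blast
  qed
  ultimately show ?thesis by auto
qed

lemma wall_partition_tito_of:
  assumes R: "bracket_rel R"
  shows "wall_partition n (tito_of R) = UNIV // block_rel R"
proof -
  let ?P = "UNIV // block_rel R"
  note same = same_block_quotient[OF equiv_block_rel[OF R]]
  have tincp: "tincp n ?P"
    unfolding tincp_def same using noncrossing_blocks[OF R] block_rel_shift[OF R] by simp
  have "wall_partition n (tito_of R) = (THE \<rho>. tincp n \<rho> \<and> (\<forall>a b. wall R a b \<longrightarrow> same_block \<rho> a b) \<and>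
    (\<forall>\<tau>. tincp n \<tau> \<and> (\<forall>a b. wall R a b \<longrightarrow> same_block \<tau> a b) \<longrightarrow> refines UNIV \<rho> \<tau>))"
    unfolding wall_partition_def Union_lower_walls[OF R] by simp
  also have "\<dots> = ?P"
  proof (rule the_equality)
    have finest: "refines UNIV ?P \<tau>" if \<tau>: "tincp n \<tau>" "\<And>a b. wall R a b \<Longrightarrow> same_block \<tau> a b" for \<tau>
    proof -
      have part: "partition_on UNIV \<tau>" using \<tau>(1) unfolding tincp_def noncrossing_def by blast
      have "same_block \<tau> x y" if "(x, y) \<in> block_rel R" for x y
      proof (rule walls_generate_blocks[OF R, of "same_block \<tau>"])
        show "same_block \<tau> y x" if "same_block \<tau> x y" for x y using that same_block_sym by metis
      qed (use same_block_refl[OF part] same_block_trans[OF part] \<tau>(2) that in simp_all)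
      then show ?thesis
        unfolding refines_iff_same_block[OF noncrossing_partition_on[OF noncrossing_blocks[OF R]] part] same
        by blast
    qed
    then show P: "tincp n ?P \<and> (\<forall>a b. wall R a b \<longrightarrow> same_block ?P a b) \<and>
      (\<forall>\<tau>. tincp n \<tau> \<and> (\<forall>a b. wall R a b \<longrightarrow> same_block \<tau> a b) \<longrightarrow> refines UNIV ?P \<tau>)"
      using tincp wall_same_block[OF R] same by blast
    fix \<rho>
    assume "tincp n \<rho> \<and> (\<forall>a b. wall R a b \<longrightarrow> same_block \<rho> a b) \<and>
      (\<forall>\<tau>. tincp n \<tau> \<and> (\<forall>a b. wall R a b \<longrightarrow> same_block \<tau> a b) \<longrightarrow> refines UNIV \<rho> \<tau>)"
    then have "refines UNIV \<rho> ?P" "refines UNIV ?P \<rho>" using P by simp_all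
    then show "\<rho> = ?P" by (rule refines_asym)
  qed
  finally show ?thesis .
qed

text \<open>
  In the image under rowmotion, the walls \<open>(a, b)\<close> of \<open>R\<close> are the upper walls. A wall leaving
  \<open>{i<..j}\<close> on the right separates the values at \<open>i\<close> and \<open>j\<close>, and a wall entering it from the left
  keeps \<open>i\<close> from reaching \<open>j\<close>.
\<close>

lemma row_block_iff:
  assumes R: "bracket_rel R" and "i < j"
  shows "(i, j) \<in> block_rel (row_rel R) \<longleftrightarrow>
    (\<forall>a b. wall R a b \<longrightarrow> (a \<in> {i<..j} \<longleftrightarrow> b \<in> {i<..j}))"
proof
  let ?S = "row_rel R"
  note S = bracket_row[OF R]
  assume ij: "(i, j) \<in> block_rel ?S"
  have ijS: "(i, j) \<in> ?S" using block_rel_bracket[OF S ij] \<open>i < j\<close> by simp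
  show "\<forall>a b. wall R a b \<longrightarrow> (a \<in> {i<..j} \<longleftrightarrow> b \<in> {i<..j})"
  proof (intro allI impI iffI)
    fix a b assume W: "wall R a b"
    then have "a < b" by (simp add: wall_def)
    show "b \<in> {i<..j}" if a: "a \<in> {i<..j}"
    proof (rule ccontr)
      assume "b \<notin> {i<..j}"
      then have "j < b" using a \<open>a < b\<close> by simp
      have "(i, a) \<in> ?S" using bracket_convex[OF S ijS] a by simp
      then have "(i, b) \<in> ?S" using up_wall_row_iff[OF R] W a by (auto simp: up_wall_def)
      then have "(j, b) \<in> ?S" using ij \<open>i < j\<close> \<open>j < b\<close> unfolding block_rel_def by auto
      then show False using W a \<open>j < b\<close> by (auto simp: row_rel_def)
    qed
    show "a \<in> {i<..j}" if b: "b \<in> {i<..j}"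
    proof (rule ccontr)
      assume "a \<notin> {i<..j}"
      then have "a \<le> i" using b \<open>a < b\<close> by simp
      then have "j < b" using ijS W b by (auto simp: row_rel_def)
      then show False using b by simp
    qed
  qed
next
  let ?S = "row_rel R"
  note S = bracket_row[OF R]
  assume cut: "\<forall>a b. wall R a b \<longrightarrow> (a \<in> {i<..j} \<longleftrightarrow> b \<in> {i<..j})"
  have ijS: "(i, j) \<in> ?S"
    unfolding row_rel_def using cut \<open>i < j\<close> by fastforce
  have "(j, d) \<in> ?S" if "j \<le> d" "(i, d) \<in> ?S" for d
    unfolding row_rel_def
  proof (clarsimp simp: \<open>j \<le> d\<close>)
    fix a b assume W: "wall R a b" "a \<le> j" "j < b"
    then have "a \<le> i" using cut by fastforce
    then show "d < b" using that W \<open>i < j\<close> by (auto simp: row_rel_def)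
  qed
  then show "(i, j) \<in> block_rel ?S"
    using ijS \<open>i < j\<close> bracket_trans[OF S] unfolding block_rel_def by auto
qed

lemma krew_blocks:
  assumes R: "bracket_rel R"
  shows "krew (UNIV // block_rel R) = UNIV // block_rel (row_rel R)"
proof (rule krew_eqI)
  note S = bracket_row[OF R]
  show "noncrossing (UNIV // block_rel R)" "noncrossing (UNIV // block_rel (row_rel R))"
    using noncrossing_blocks[OF R] noncrossing_blocks[OF S] by simp_all
  fix i j :: int assume "i < j"
  have "(\<forall>a b. wall R a b \<longrightarrow> (a \<in> {i<..j} \<longleftrightarrow> b \<in> {i<..j})) \<longleftrightarrow>
    (\<forall>x y. (x, y) \<in> block_rel R \<longrightarrow> (x \<in> {i<..j} \<longleftrightarrow> y \<in> {i<..j}))"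
  proof
    assume cut: "\<forall>a b. wall R a b \<longrightarrow> (a \<in> {i<..j} \<longleftrightarrow> b \<in> {i<..j})"
    show "\<forall>x y. (x, y) \<in> block_rel R \<longrightarrow> (x \<in> {i<..j} \<longleftrightarrow> y \<in> {i<..j})"
    proof (intro allI impI)
      fix x y assume xy: "(x, y) \<in> block_rel R"
      show "x \<in> {i<..j} \<longleftrightarrow> y \<in> {i<..j}"
        by (rule walls_generate_blocks[OF R, of "\<lambda>x y. x \<in> {i<..j} \<longleftrightarrow> y \<in> {i<..j}"])
          (use cut xy in simp_all)
    qed
  qed (use wall_same_block[OF R] in blast)
  then show "same_block (UNIV // block_rel (row_rel R)) i j \<longleftrightarrow>
    (\<forall>x y. same_block (UNIV // block_rel R) x y \<longrightarrow> (x \<in> {i<..j} \<longleftrightarrow> y \<in> {i<..j}))"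
    unfolding same_block_quotient[OF equiv_block_rel[OF R]] same_block_quotient[OF equiv_block_rel[OF S]]
    using row_block_iff[OF R \<open>i < j\<close>] by simp
qed

end

theorem proposition9p2:
  fixes n :: int and r :: "int rel"
  assumes "n \<ge> 2"
    and "r \<in> carrier (CTam312 n)"
  shows "wall_partition n (rowmotion (CTam312 n) r) = krew (wall_partition n r)"
proof -
  interpret bracket_period n using assms(1) by unfold_locales simp
  obtain R where R: "bracket_rel R" "r = tito_of R" using assms(2) by (rule carrier_cases)
  have "wall_partition n (rowmotion (CTam312 n) r) = UNIV // block_rel (row_rel R)"
    using wall_partition_tito_of[OF bracket_row] rowmotion_tito_of R by simp
  also have "\<dots> = krew (wall_partition n r)"
    using krew_blocks wall_partition_tito_of R by simp
  finally show ?thesis .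
qed

end
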